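(* Consider the modal macro-micro BUG scheme (the rank-adaptive scheme with basis augmentation and asymptotic-preserving truncation) for the linearized problem (linear emission, $\Psi\equiv1$), one step of which is written out in the context. Assume that the time step $\Delta t$ fulfills, for all $k\in\{1,\dots,N+1\}$ with $\mu_k\ne0$, the CFL condition $$\Delta t\le\frac{1}{5c\,\beta_N}\left(\frac{2\varepsilon\Delta x}{|\mu_k|}+\frac{\sigma_0\Delta x^{2}}{\mu_k^{2}}\right),\qquad \beta_N=\max_k w_k(N+1).$$ Then the scheme is energy stable, that is, $e^{n+1}\le e^n$, where $$e^{n}=\left\|aT^{n}+\frac{\varepsilon^{2}}{c}h^{n}\right\|^{2}+\left\|\frac{\varepsilon}{\gamma_0c}\mathbf X^{n}\mathbf S^{n}\mathbf V^{n,\top}\right\|^{2}+\left\|\sqrt{\frac{a c_\nu}{2}}\,T^{n}\right\|^{2}.$$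
   Context: Parameters: $\varepsilon>0$, $c>0$ (speed of light), $a>0$ (radiation constant), $c_\nu>0$ (specific heat), $\kappa=2/c_\nu$. The absorption coefficient $\sigma^a(x)$ satisfies $\sigma^a(x)\ge\sigma_0>0$. Angular discretization: $N\ge1$ is an integer; $P_k$ is the $k$-th Legendre polynomial normalized in $L^2([-1,1])$; $\gamma_0=\sqrt2$, $\gamma_1=\sqrt{2/3}$; $(\mu_k,w_k)_{k=1}^{N+1}$ are the nodes and weights of the $(N+1)$-point Gauss-Legendre quadrature on $[-1,1]$. Let $\mathbf T\in\mathbb R^{N\times(N+1)}$ with $\mathbf T_{jk}=\sqrt{w_k}P_j(\mu_k)$, $j=1,\dots,N$, $\mathbf M=\mathrm{diag}(\mu_k)$, $|\mathbf M|=\mathrm{diag}(|\mu_k|)$, $\mathbf A^{\pm}=\frac12\mathbf T(\mathbf M\pm|\mathbf M|)\mathbf T^\top$, $\mathbf b=(\gamma_1,0,\dots,0)^\top\in\mathbb R^N$, and $\mathbf e_1=(1,0,\dots,0)^\top\in\mathbb R^N$. Grid: uniform staggered grid with $N_x$ cells, mesh width $\Delta x$, midpoints $x_i$ ($i=1,\dots,N_x$) and interfaces $x_{i+1/2}$. Temperature $T$ and mesoscopic variable $h$ (scalars) live at midpoints; the microscopic moments live at interfaces. $\sigma^a_i=\sigma^a(x_i)$, $\sigma^a_{i+1/2}=\sigma^a(x_{i+1/2})$. For interface functions $\mathcal D^-u_{i+1/2}=(u_{i+1/2}-u_{i-1/2})/\Delta x$, $\mathcal D^+u_{i+1/2}=(u_{i+3/2}-u_{i+1/2})/\Delta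 x$, $\mathcal D^0u_i=(u_{i+1/2}-u_{i-1/2})/\Delta x$; for midpoint functions $\delta^0u_{i+1/2}=(u_{i+1}-u_i)/\Delta x$. Boundary conditions are periodic (indices modulo $N_x$, interface index set $J=\{1,\dots,N_x\}$) or zero (interface quantities vanish at and outside the two boundary interfaces, $J=\{1,\dots,N_x-1\}$); sums over interfaces are over $J$. Norms: $\|u\|^2=\sum_iu_i^2\Delta x$ for midpoint functions; $\|\mathbf G\|^2=\|\mathbf G\|_F^2\,\Delta x$ for $\mathbf G\in\mathbb R^{|J|\times N}$ ($F$ = Frobenius). Low-rank representation: $\mathbf g^n=\mathbf X^n\mathbf S^n\mathbf V^{n,\top}\in\mathbb R^{|J|\times N}$ of current rank $r$ (with $2r+1\le\min(|J|,N)$), where $\mathbf X^n\in\mathbb R^{|J|\times r}$ and $\mathbf V^n\in\mathbb R^{N\times r}$ have orthonormal columns and $\mathbf S^n\in\mathbb R^{r\times r}$. The row with index $i$ of a spatial basis $\mathbf X$ is written $X^\top_{i+1/2}$. Abbreviate $s^n_{i+1/2}=\delta^0(ac\,T^n_{i+1/2}+\varepsilon^2h^n_{i+1/2})$, and let $\mathbf y^n\in\mathbb R^{|J|}$ have entries $y^n_{i+1/2}=(\sigma^a_{i+1/2})^{-1}\delta^0(ac\,T^n_{i+1/2})$. One step of the scheme (linearized, $\Psi\equiv1$), given $\mathbf X^n,\mathbf S^n,\mathbf V^n,h^n,T^n$: 1a. K-step: with $K^{n,\top}_{i+1/2}=X^{n,\top}_{i+1/2}\mathbf S^n$, solve $$\tfrac{\varepsilon^2}{c}\tfrac{K^{n+1}_{i+1/2}-K^n_{i+1/2}}{\Delta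 t}=-\varepsilon\left([\mathbf V^{n,\top}\mathbf A^+\mathbf V^n]\mathcal D^-K^n_{i+1/2}+[\mathbf V^{n,\top}\mathbf A^-\mathbf V^n]\mathcal D^+K^n_{i+1/2}\right)-\mathbf V^{n,\top}\mathbf b\,s^n_{i+1/2}-\sigma^a_{i+1/2}K^{n+1}_{i+1/2},$$ let $\mathbf K^{n+1}\in\mathbb R^{|J|\times r}$ have rows $K^{n+1,\top}_{i+1/2}$, and let $\widehat{\mathbf X}^{n+1}\in\mathbb R^{|J|\times(2r+1)}$ have orthonormal columns forming an orthonormal basis of $[\mathbf y^n\ \ \mathbf K^{n+1}\ \ \mathbf X^n]$ (its range contains these columns). 1b. L-step: with $\mathbf L^n=\mathbf V^n\mathbf S^{n,\top}$, solve $$\tfrac{\varepsilon^2}{c}\tfrac{\mathbf L^{n+1}-\mathbf L^n}{\Delta t}=-\varepsilon\left(\mathbf A^+\mathbf L^n\sum_i\mathcal D^-X^n_{i+1/2}X^{n,\top}_{i+1/2}+\mathbf A^-\mathbf L^n\sum_i\mathcal D^+X^n_{i+1/2}X^{n,\top}_{i+1/2}\right)-\mathbf b\sum_iX^{n,\top}_{i+1/2}s^n_{i+1/2}-\mathbf L^{n+1}\sum_i\sigma^a_{i+1/2}X^n_{i+1/2}X^{n,\top}_{i+1/2},$$ and let $\widehat{\mathbf V}^{n+1}\in\mathbb R^{N\times(2r+1)}$ have orthonormal columns forming an orthonormal basis of $[\mathbf b\ \ \mathbf L^{n+1}\ \ \mathbf V^n]$ (its range contains these columns), with first column $\mathbf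 b/\|\mathbf b\|$. 2. Galerkin step: with $\widetilde{\mathbf S}^n=\widehat{\mathbf X}^{n+1,\top}\mathbf X^n\,\mathbf S^n\,\mathbf V^{n,\top}\widehat{\mathbf V}^{n+1}$, find $\widehat{\mathbf S}^{n+1}\in\mathbb R^{(2r+1)\times(2r+1)}$ with $$\tfrac{\varepsilon^2}{c}\tfrac{\widehat{\mathbf S}^{n+1}-\widetilde{\mathbf S}^n}{\Delta t}=-\varepsilon\,\mathcal L_S\widetilde{\mathbf S}^n-\sum_i\widehat X^{n+1}_{i+1/2}s^n_{i+1/2}\,\mathbf b^\top\widehat{\mathbf V}^{n+1}-\sum_i\sigma^a_{i+1/2}\widehat X^{n+1}_{i+1/2}\widehat X^{n+1,\top}_{i+1/2}\widehat{\mathbf S}^{n+1},$$ $$\mathcal L_S\mathbf S=\sum_i\widehat X^{n+1}_{i+1/2}\mathcal D^-\widehat X^{n+1,\top}_{i+1/2}\mathbf S\widehat{\mathbf V}^{n+1,\top}\mathbf A^+\widehat{\mathbf V}^{n+1}+\sum_i\widehat X^{n+1}_{i+1/2}\mathcal D^+\widehat X^{n+1,\top}_{i+1/2}\mathbf S\widehat{\mathbf V}^{n+1,\top}\mathbf A^-\widehat{\mathbf V}^{n+1}.$$ 3. Splitting and truncation: set $\widehat{\mathbf K}=\widehat{\mathbf X}^{n+1}\widehat{\mathbf S}^{n+1}=[\widehat{\mathbf K}^{\rm ap}\ \ \widehat{\mathbf K}^{\rm rem}]$ and $\widehat{\mathbf V}^{n+1}=[\widehat{\mathbf V}^{\rm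 ap}\ \ \widehat{\mathbf V}^{\rm rem}]$, where "ap" denotes the first column (for $\widehat{\mathbf V}^{\rm ap}$: $\mathbf b/\|\mathbf b\|$) and "rem" the remaining $2r$ columns. Compute QR decompositions $\widehat{\mathbf K}^{\rm rem}=\widehat{\mathbf X}^{\rm rem}\widehat{\mathbf S}^{\rm rem}$ and $\widehat{\mathbf K}^{\rm ap}=\mathbf X^{\rm ap}\mathbf S^{\rm ap}$, and the SVD $\widehat{\mathbf S}^{\rm rem}=\mathbf U\boldsymbol\Sigma\mathbf W^\top$ with singular values $\hat\sigma_1\ge\dots\ge\hat\sigma_{2r}$. For a user tolerance $\vartheta$ choose $1\le r^*\le2r$ with $\big(\sum_{i=r^*+1}^{2r}\hat\sigma_i^2\big)^{1/2}\le\vartheta$; set $r_1=r^*+1$. Let $\widehat{\mathbf U},\widehat{\mathbf W}$ be the first $r^*$ columns of $\mathbf U,\mathbf W$ and $\widehat{\boldsymbol\Sigma}$ the leading $r^*\times r^*$ block of $\boldsymbol\Sigma$. Put $\mathbf X^{\rm rem}=\widehat{\mathbf X}^{\rm rem}\widehat{\mathbf U}$, $\mathbf S^{\rm rem}=\widehat{\boldsymbol\Sigma}$, $\mathbf V^{n+1}=[\widehat{\mathbf V}^{\rm ap}\ \ \widehat{\mathbf V}^{\rm rem}\widehat{\mathbf W}]\in\mathbb R^{N\times r_1}$; compute the QR decomposition $\mathbf X^{n+1}\mathbf R_2=[\mathbf X^{\rm ap}\ \ \mathbf X^{\rm rem}]$ with $\mathbf X^{n+1}\in\mathbb R^{|J|\times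 r_1}$; set $\mathbf S^{n+1}=\mathbf R_2\begin{bmatrix}\mathbf S^{\rm ap}&0\\0&\mathbf S^{\rm rem}\end{bmatrix}$ and $\mathbf g^{n+1}=\mathbf X^{n+1}\mathbf S^{n+1}\mathbf V^{n+1,\top}$. 4. Update of $h,T$: with $g^{n+1}_{1,i+1/2}=X^{n+1,\top}_{i+1/2}\mathbf S^{n+1}\mathbf V^{n+1,\top}\mathbf e_1$, $$\tfrac{\varepsilon^2}{c}\tfrac{h^{n+1}_i-h^n_i}{\Delta t}+a\kappa\sigma^a_ih^{n+1}_i+\tfrac{\gamma_1}{2}\mathcal D^0g^{n+1}_{1,i}=-\sigma^a_ih^{n+1}_i,\qquad \tfrac{T^{n+1}_i-T^n_i}{\Delta t}=\kappa\sigma^a_ih^{n+1}_i.$$ *)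

theory Defs
  imports "HOL-Analysis.Analysis" "HOL-Computational_Algebra.Polynomial" "Jordan_Normal_Form.Matrix"
begin

(* Vectors and matrices are those of Jordan_Normal_Form.Matrix throughout, because the rank changes
   within one step. *)
hide_type (open) Finite_Cartesian_Product.vec
hide_const (open) Finite_Cartesian_Product.vec Finite_Cartesian_Product.row
  Finite_Cartesian_Product.column Finite_Cartesian_Product.mat Finite_Cartesian_Product.transpose
unbundle no vec_syntax
unbundle no inner_syntax

section \<open>Legendre polynomials and Gauss-Legendre quadrature\<close>

(* Rodrigues' formula *)
definition legendre :: "nat \<Rightarrow> real poly" where
  "legendre k = Polynomial.smult (1 / (2 ^ k * fact k)) ((pderiv ^^ k) ([:-1, 0, 1:] ^ k))"

definition legendre_normalized :: "nat \<Rightarrow> real poly" where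
  "legendre_normalized k =
     Polynomial.smult (1 / sqrt (integral {-1..1} (\<lambda>x. (poly (legendre k) x)\<^sup>2))) (legendre k)"

(* The nodes are the roots of the n-th Legendre polynomial (in any order), the weights are the
   integrals of the associated Lagrange basis polynomials. *)
definition gauss_legendre :: "nat \<Rightarrow> (nat \<Rightarrow> real) \<Rightarrow> (nat \<Rightarrow> real) \<Rightarrow> bool" where
  "gauss_legendre n \<mu> w \<longleftrightarrow>
     inj_on \<mu> {..<n} \<and>
     (\<forall>k<n. poly (legendre n) (\<mu> k) = 0 \<and>
       w k = integral {-1..1} (\<lambda>x. \<Prod>j\<in>{..<n} - {k}. (x - \<mu> j) / (\<mu> k - \<mu> j)))"


section \<open>Matrices\<close>

definition orthonormal_cols :: "real mat \<Rightarrow> bool" where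
  "orthonormal_cols Q \<longleftrightarrow> transpose_mat Q * Q = 1\<^sub>m (dim_col Q)"

definition col_range :: "real mat \<Rightarrow> real vec set" where
  "col_range A = {A *\<^sub>v x | x. x \<in> carrier_vec (dim_col A)}"

definition first_cols :: "nat \<Rightarrow> real mat \<Rightarrow> real mat" where
  "first_cols k A = mat_of_cols (dim_row A) (take k (cols A))"

definition drop_cols :: "nat \<Rightarrow> real mat \<Rightarrow> real mat" where
  "drop_cols k A = mat_of_cols (dim_row A) (drop k (cols A))"

definition hcat :: "real mat \<Rightarrow> real mat \<Rightarrow> real mat" where
  "hcat A B = mat_of_cols (dim_row A) (cols A @ cols B)"

definition outer_prod :: "real vec \<Rightarrow> real vec \<Rightarrow> real mat" where
  "outer_prod u v = mat (dim_vec u) (dim_vec v) (\<lambda>(i, j). u $ i * v $ j)"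

definition vec_norm :: "real vec \<Rightarrow> real" where
  "vec_norm v = sqrt (v \<bullet> v)"

definition frobenius_norm :: "real mat \<Rightarrow> real" where
  "frobenius_norm A = sqrt (\<Sum>i<dim_row A. \<Sum>j<dim_col A. (A $$ (i, j))\<^sup>2)"

definition is_QR :: "real mat \<Rightarrow> real mat \<Rightarrow> real mat \<Rightarrow> bool" where
  "is_QR A Q R \<longleftrightarrow>
     Q \<in> carrier_mat (dim_row A) (dim_col A) \<and> R \<in> carrier_mat (dim_col A) (dim_col A) \<and>
     orthonormal_cols Q \<and> upper_triangular R \<and> A = Q * R"

definition is_SVD :: "real mat \<Rightarrow> real mat \<Rightarrow> (nat \<Rightarrow> real) \<Rightarrow> real mat \<Rightarrow> bool" where
  "is_SVD A U sv W \<longleftrightarrow>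
     (let n = dim_row A in
        A \<in> carrier_mat n n \<and> U \<in> carrier_mat n n \<and> W \<in> carrier_mat n n \<and>
        orthonormal_cols U \<and> orthonormal_cols W \<and>
        (\<forall>i<n. 0 \<le> sv i) \<and> (\<forall>i j. i \<le> j \<and> j < n \<longrightarrow> sv j \<le> sv i) \<and>
        A = U * mat_diag n sv * transpose_mat W)"


section \<open>Staggered grid\<close>

text \<open>
  All indices start at 0. The midpoints are \<open>xleft + (i + 1/2) * dx\<close> for \<open>i < Nx\<close>; entry (or row)
  \<open>j\<close> of an interface quantity belongs to the interface \<open>xleft + (j + 1) * dx\<close> between the
  midpoints \<open>j\<close> and \<open>j + 1\<close>. The left boundary interface \<open>xleft\<close> thus has index \<open>-1\<close>.
\<close>

datatype boundary = Periodic | Zero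

definition num_ifaces :: "boundary \<Rightarrow> nat \<Rightarrow> nat" where
  "num_ifaces bc nx = (case bc of Periodic \<Rightarrow> nx | Zero \<Rightarrow> nx - 1)"

definition iface_val :: "boundary \<Rightarrow> real vec \<Rightarrow> int \<Rightarrow> real" where
  "iface_val bc u j = (case bc of
       Periodic \<Rightarrow> u $ nat (j mod int (dim_vec u))
     | Zero \<Rightarrow> if 0 \<le> j \<and> j < int (dim_vec u) then u $ nat j else 0)"

record bug_params =
  eps :: real
  light :: real
  rad :: real
  cnu :: real
  sigma :: "real \<Rightarrow> real"
  sigma0 :: real
  Nang :: nat
  mu :: "nat \<Rightarrow> real"
  wt :: "nat \<Rightarrow> real"
  bc :: boundary
  Nx :: nat
  xleft :: real
  dx :: real
  dt :: real

definition admissible :: "bug_params \<Rightarrow> bool" where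
  "admissible p \<longleftrightarrow>
     0 < eps p \<and> 0 < light p \<and> 0 < rad p \<and> 0 < cnu p \<and>
     0 < sigma0 p \<and> (\<forall>x\<in>{xleft p..xleft p + real (Nx p) * dx p}. sigma0 p \<le> sigma p x) \<and>
     1 \<le> Nang p \<and> gauss_legendre (Nang p + 1) (mu p) (wt p) \<and>
     1 \<le> Nx p \<and> 0 < dx p \<and> 0 < dt p"

definition kappa :: "bug_params \<Rightarrow> real" where
  "kappa p = 2 / cnu p"

abbreviation nJ :: "bug_params \<Rightarrow> nat" where
  "nJ p \<equiv> num_ifaces (bc p) (Nx p)"

definition sigma_mid :: "bug_params \<Rightarrow> nat \<Rightarrow> real" where
  "sigma_mid p i = sigma p (xleft p + (real i + 1 / 2) * dx p)"

definition sigma_iface :: "bug_params \<Rightarrow> nat \<Rightarrow> real" where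
  "sigma_iface p j = sigma p (xleft p + (real j + 1) * dx p)"

definition Dminus :: "bug_params \<Rightarrow> real mat \<Rightarrow> real mat" where
  "Dminus p G = mat (dim_row G) (dim_col G)
     (\<lambda>(j, k). (iface_val (bc p) (col G k) (int j) - iface_val (bc p) (col G k) (int j - 1)) / dx p)"

definition Dplus :: "bug_params \<Rightarrow> real mat \<Rightarrow> real mat" where
  "Dplus p G = mat (dim_row G) (dim_col G)
     (\<lambda>(j, k). (iface_val (bc p) (col G k) (int j + 1) - iface_val (bc p) (col G k) (int j)) / dx p)"

(* from interfaces to midpoints *)
definition D0 :: "bug_params \<Rightarrow> real vec \<Rightarrow> real vec" where
  "D0 p u = vec (Nx p)
     (\<lambda>i. (iface_val (bc p) u (int i) - iface_val (bc p) u (int i - 1)) / dx p)"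

(* from midpoints to interfaces; the index only wraps around in the periodic case *)
definition delta0 :: "bug_params \<Rightarrow> real vec \<Rightarrow> real vec" where
  "delta0 p u = vec (nJ p) (\<lambda>j. (u $ ((j + 1) mod Nx p) - u $ j) / dx p)"

definition mid_norm :: "bug_params \<Rightarrow> real vec \<Rightarrow> real" where
  "mid_norm p u = sqrt ((\<Sum>i<Nx p. (u $ i)\<^sup>2) * dx p)"

definition iface_norm :: "bug_params \<Rightarrow> real mat \<Rightarrow> real" where
  "iface_norm p G = sqrt ((frobenius_norm G)\<^sup>2 * dx p)"


section \<open>Angular discretization\<close>

definition \<gamma>0 :: real where "\<gamma>0 = sqrt 2"
definition \<gamma>1 :: real where "\<gamma>1 = sqrt (2 / 3)"

(* no row for the Legendre polynomial of degree 0 *)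
definition T_mat :: "bug_params \<Rightarrow> real mat" where
  "T_mat p = mat (Nang p) (Nang p + 1)
     (\<lambda>(j, k). sqrt (wt p k) * poly (legendre_normalized (j + 1)) (mu p k))"

definition M_mat :: "bug_params \<Rightarrow> real mat" where
  "M_mat p = mat_diag (Nang p + 1) (mu p)"

definition M_abs :: "bug_params \<Rightarrow> real mat" where
  "M_abs p = mat_diag (Nang p + 1) (\<lambda>k. \<bar>mu p k\<bar>)"

definition A_plus :: "bug_params \<Rightarrow> real mat" where
  "A_plus p = (1 / 2) \<cdot>\<^sub>m (T_mat p * (M_mat p + M_abs p) * transpose_mat (T_mat p))"

definition A_minus :: "bug_params \<Rightarrow> real mat" where
  "A_minus p = (1 / 2) \<cdot>\<^sub>m (T_mat p * (M_mat p - M_abs p) * transpose_mat (T_mat p))"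

definition b_vec :: "bug_params \<Rightarrow> real vec" where
  "b_vec p = \<gamma>1 \<cdot>\<^sub>v unit_vec (Nang p) 0"

definition beta :: "bug_params \<Rightarrow> real" where
  "beta p = Max ((\<lambda>k. wt p k * real (Nang p + 1)) ` {..Nang p})"


section \<open>One step of the scheme\<close>

text \<open>
  Sums of outer products over the interfaces are written as matrix products: the sum of
  \<open>u\<^sub>j v\<^sub>j\<^sup>T\<close>, where \<open>u\<^sub>j\<close> and \<open>v\<^sub>j\<close> are the rows of \<open>P\<close> and \<open>Q\<close>, is \<open>P\<^sup>T Q\<close>.
\<close>

definition s_vec :: "bug_params \<Rightarrow> real vec \<Rightarrow> real vec \<Rightarrow> real vec" where
  "s_vec p h T = delta0 p ((rad p * light p) \<cdot>\<^sub>v T + (eps p)\<^sup>2 \<cdot>\<^sub>v h)"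

definition y_vec :: "bug_params \<Rightarrow> real vec \<Rightarrow> real vec" where
  "y_vec p T =
     vec (nJ p) (\<lambda>j. inverse (sigma_iface p j) * delta0 p ((rad p * light p) \<cdot>\<^sub>v T) $ j)"

definition sigma_gram :: "bug_params \<Rightarrow> real mat \<Rightarrow> real mat" where
  "sigma_gram p X = transpose_mat X * mat_diag (nJ p) (sigma_iface p) * X"

definition k_step ::
  "bug_params \<Rightarrow> real mat \<Rightarrow> real mat \<Rightarrow> real mat \<Rightarrow> real vec \<Rightarrow> real vec \<Rightarrow> real mat \<Rightarrow> bool" where
  "k_step p X S V h T K' \<longleftrightarrow>
     (let K = X * S in
        K' \<in> carrier_mat (nJ p) (dim_col X) \<and>
        (\<forall>j<nJ p.
          ((eps p)\<^sup>2 / light p / dt p) \<cdot>\<^sub>v (row K' j - row K j) =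
            (- eps p) \<cdot>\<^sub>v ((transpose_mat V * A_plus p * V) *\<^sub>v row (Dminus p K) j
                        + (transpose_mat V * A_minus p * V) *\<^sub>v row (Dplus p K) j)
            - (s_vec p h T $ j) \<cdot>\<^sub>v (transpose_mat V *\<^sub>v b_vec p)
            - sigma_iface p j \<cdot>\<^sub>v row K' j))"

definition l_step ::
  "bug_params \<Rightarrow> real mat \<Rightarrow> real mat \<Rightarrow> real mat \<Rightarrow> real vec \<Rightarrow> real vec \<Rightarrow> real mat \<Rightarrow> bool" where
  "l_step p X S V h T L' \<longleftrightarrow>
     (let L = V * transpose_mat S in
        L' \<in> carrier_mat (Nang p) (dim_col X) \<and>
        ((eps p)\<^sup>2 / light p / dt p) \<cdot>\<^sub>m (L' - L) =
          (- eps p) \<cdot>\<^sub>m (A_plus p * L * (transpose_mat (Dminus p X) * X)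
                      + A_minus p * L * (transpose_mat (Dplus p X) * X))
          - outer_prod (b_vec p) (transpose_mat X *\<^sub>v s_vec p h T)
          - L' * sigma_gram p X)"

definition x_augmented ::
  "bug_params \<Rightarrow> real mat \<Rightarrow> real vec \<Rightarrow> real mat \<Rightarrow> real mat \<Rightarrow> bool" where
  "x_augmented p X T K' Xh \<longleftrightarrow>
     Xh \<in> carrier_mat (nJ p) (2 * dim_col X + 1) \<and> orthonormal_cols Xh \<and>
     {y_vec p T} \<union> set (cols K') \<union> set (cols X) \<subseteq> col_range Xh"

definition v_augmented ::
  "bug_params \<Rightarrow> real mat \<Rightarrow> real mat \<Rightarrow> real mat \<Rightarrow> bool" where
  "v_augmented p V L' Vh \<longleftrightarrow>
     Vh \<in> carrier_mat (Nang p) (2 * dim_col V + 1) \<and> orthonormal_cols Vh \<and>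
     {b_vec p} \<union> set (cols L') \<union> set (cols V) \<subseteq> col_range Vh \<and>
     col Vh 0 = (1 / vec_norm (b_vec p)) \<cdot>\<^sub>v b_vec p"

definition LS :: "bug_params \<Rightarrow> real mat \<Rightarrow> real mat \<Rightarrow> real mat \<Rightarrow> real mat" where
  "LS p Xh Vh S =
     transpose_mat Xh * Dminus p Xh * S * (transpose_mat Vh * A_plus p * Vh)
     + transpose_mat Xh * Dplus p Xh * S * (transpose_mat Vh * A_minus p * Vh)"

definition galerkin_step ::
  "bug_params \<Rightarrow> real mat \<Rightarrow> real mat \<Rightarrow> real mat \<Rightarrow> real vec \<Rightarrow> real vec \<Rightarrow>
   real mat \<Rightarrow> real mat \<Rightarrow> real mat \<Rightarrow> bool" where
  "galerkin_step p X S V h T Xh Vh Sh \<longleftrightarrow>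
     (let St = transpose_mat Xh * X * S * transpose_mat V * Vh in
        Sh \<in> carrier_mat (dim_col Xh) (dim_col Vh) \<and>
        ((eps p)\<^sup>2 / light p / dt p) \<cdot>\<^sub>m (Sh - St) =
          (- eps p) \<cdot>\<^sub>m LS p Xh Vh St
          - outer_prod (transpose_mat Xh *\<^sub>v s_vec p h T) (transpose_mat Vh *\<^sub>v b_vec p)
          - sigma_gram p Xh * Sh)"

definition truncation ::
  "real \<Rightarrow> real mat \<Rightarrow> real mat \<Rightarrow> real mat \<Rightarrow> real mat \<Rightarrow> real mat \<Rightarrow> real mat \<Rightarrow> bool" where
  "truncation \<theta> Xh Sh Vh X' S' V' \<longleftrightarrow>
     (\<exists>Xap Sap Xrem Srem U sv W rs R2.
        is_QR (drop_cols 1 (Xh * Sh)) Xrem Srem \<and>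
        is_QR (first_cols 1 (Xh * Sh)) Xap Sap \<and>
        is_SVD Srem U sv W \<and>
        1 \<le> rs \<and> rs \<le> dim_row Srem \<and> sqrt (\<Sum>i = rs..<dim_row Srem. (sv i)\<^sup>2) \<le> \<theta> \<and>
        is_QR (hcat Xap (Xrem * first_cols rs U)) X' R2 \<and>
        S' = R2 * four_block_mat Sap (0\<^sub>m 1 rs) (0\<^sub>m rs 1) (mat_diag rs sv) \<and>
        V' = hcat (first_cols 1 Vh) (drop_cols 1 Vh * first_cols rs W))"

definition ht_update ::
  "bug_params \<Rightarrow> real vec \<Rightarrow> real vec \<Rightarrow> real mat \<Rightarrow> real mat \<Rightarrow> real mat \<Rightarrow>
   real vec \<Rightarrow> real vec \<Rightarrow> bool" where
  "ht_update p h T X' S' V' h' T' \<longleftrightarrow>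
     (let g1 = X' * S' * transpose_mat V' *\<^sub>v unit_vec (Nang p) 0 in
        h' \<in> carrier_vec (Nx p) \<and> T' \<in> carrier_vec (Nx p) \<and>
        (\<forall>i<Nx p.
          (eps p)\<^sup>2 / light p * ((h' $ i - h $ i) / dt p)
            + rad p * kappa p * sigma_mid p i * h' $ i + \<gamma>1 / 2 * D0 p g1 $ i
            = - sigma_mid p i * h' $ i \<and>
          (T' $ i - T $ i) / dt p = kappa p * sigma_mid p i * h' $ i))"

definition bug_step ::
  "bug_params \<Rightarrow> real \<Rightarrow> real mat \<Rightarrow> real mat \<Rightarrow> real mat \<Rightarrow> real vec \<Rightarrow> real vec \<Rightarrow>
   real mat \<Rightarrow> real mat \<Rightarrow> real mat \<Rightarrow> real vec \<Rightarrow> real vec \<Rightarrow> bool" where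
  "bug_step p \<theta> X S V h T X' S' V' h' T' \<longleftrightarrow>
     (\<exists>K' Xh L' Vh Sh.
        k_step p X S V h T K' \<and> x_augmented p X T K' Xh \<and>
        l_step p X S V h T L' \<and> v_augmented p V L' Vh \<and>
        galerkin_step p X S V h T Xh Vh Sh \<and>
        truncation \<theta> Xh Sh Vh X' S' V' \<and>
        ht_update p h T X' S' V' h' T')"

definition energy ::
  "bug_params \<Rightarrow> real mat \<Rightarrow> real mat \<Rightarrow> real mat \<Rightarrow> real vec \<Rightarrow> real vec \<Rightarrow> real" where
  "energy p X S V h T =
     (mid_norm p (rad p \<cdot>\<^sub>v T + ((eps p)\<^sup>2 / light p) \<cdot>\<^sub>v h))\<^sup>2
     + (iface_norm p ((eps p / (\<gamma>0 * light p)) \<cdot>\<^sub>m (X * S * transpose_mat V)))\<^sup>2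
     + (mid_norm p (sqrt (rad p * cnu p / 2) \<cdot>\<^sub>v T))\<^sup>2"

end

theory Submission
  imports Defs
begin

text \<open>
  The augmented bases reproduce the old solution, so testing the Galerkin step with its own solution
  \<open>gh\<close> gives the energy balance of the full-rank scheme. As \<open>T T\<^sup>T = I\<close> by exactness of the
  quadrature, that balance decouples into scalar upwind schemes for the nodal values \<open>gh T\<close>, in
  which the upwind dissipation and the absorption dominate the explicit error under the CFL
  condition, with a surplus proportional to the sum of \<open>\<mu>\<^sub>k\<^sup>2\<close> times the squared jumps. The coupling
  terms of \<open>g\<close> and of \<open>aT + \<epsilon>\<^sup>2/c h\<close> cancel by summation by parts, except for the jumps of the first
  moment against the increment of \<open>aT + \<epsilon>\<^sup>2/c h\<close>; the surplus absorbs this. The truncation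
  multiplies the coefficients by an orthogonal projection that fixes the first basis vector, so it
  does not increase the norm and leaves the first moment unchanged.
\<close>

section \<open>Exactness of Gauss-Legendre quadrature\<close>

text \<open>The flux uses the old \<open>g\<close> while the test function is the new
  \<open>gh\<close>, so \<open>gh - g\<close> enters the flux terms; only the squared increment left
  by polarizing the time difference can pay for it. The Young weight \<epsilon> dx / (2 c dt) spends
  all of it, at the price of 2 units of c dt \<mu>^2 / (4 dx^2) per squared jump of a nodal value.
  Upwinding and absorption, matching the two summands of the CFL bound, supply at least 5 \<beta>
  \<ge> 10 such units; \<beta> \<ge> 2 because the weights sum to 2. The remaining 8 units become
  2/3 c dt / dx^2 on the squared jumps of the first moment. The moment equation sees the old total
  radiation, the macroscopic update the new first moment, so the coupling cancels only up to the
  increment of the radiation. Completing a square bounds this rest by 1/6 (dt / dx)^2 times the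
  squared jumps, where 1/6 is a quarter of the square of \<open>\<gamma>1\<close>. In the same units
  the surplus is 2/3 (dt / dx)^2. \<open>T_mat\<close> has more columns than rows, so passing to
  nodal values is an isometric embedding and not a change of basis; norms and fluxes need no
  more.\<close>

definition poly_integral :: "real poly \<Rightarrow> real" where
  "poly_integral p = integral {-1..1} (poly p)"

lemma poly_integral_eq:
  assumes "\<And>x. poly p x = f x"
  shows "poly_integral p = integral {-1..1} f"
proof -
  have "poly p = f" using assms by (rule ext)
  then show ?thesis by (simp add: poly_integral_def)
qed

lemma poly_integrable: "(poly (p :: real poly)) integrable_on {a..b}"
  by (intro integrable_continuous_real continuous_intros)

lemma poly_integral_add: "poly_integral (p + q) = poly_integral p + poly_integral q"
  unfolding poly_integral_def poly_add
  by (rule Henstock_Kurzweil_Integration.integral_add) (rule poly_integrable)+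

lemma poly_integral_smult: "poly_integral (Polynomial.smult c p) = c * poly_integral p"
  by (subst poly_integral_eq[of _ "\<lambda>x. c * poly p x"]) (simp_all add: poly_integral_def)

lemma poly_integral_0 [simp]: "poly_integral 0 = 0"
  using poly_integral_smult[of 0 0] by simp

lemma poly_integral_sum: "poly_integral (\<Sum>k\<in>A. f k) = (\<Sum>k\<in>A. poly_integral (f k))"
  by (induction A rule: infinite_finite_induct) (simp_all add: poly_integral_add)

lemma poly_integral_pderiv: "poly_integral (pderiv p) = poly p 1 - poly p (-1)"
proof -
  have "((poly (pderiv p)) has_integral (poly p 1 - poly p (-1))) {-1..1}"
    by (rule fundamental_theorem_of_calculus)
       (auto intro!: DERIV_subset[OF poly_DERIV] simp: has_real_derivative_iff_has_vector_derivative[symmetric])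
  then show ?thesis
    unfolding poly_integral_def by (rule integral_unique)
qed

lemma poly_integral_square_pos:
  assumes "p \<noteq> 0"
  shows "poly_integral (p * p) > 0"
proof -
  have "poly_integral (p * p) \<ge> 0"
    unfolding poly_integral_def by (rule Henstock_Kurzweil_Integration.integral_nonneg) (auto simp: poly_integrable[unfolded poly_mult])
  moreover have "poly_integral (p * p) \<noteq> 0"
  proof
    assume "poly_integral (p * p) = 0"
    then have "\<forall>x\<in>{-1..1}. poly (p * p) x = 0"
      unfolding poly_integral_def
      by (subst (asm) integral_eq_0_iff) (auto intro!: continuous_intros)
    then have "{-1..1} \<subseteq> {x. poly p x = 0}" by auto
    then have "finite {-1..1::real}"
      using poly_roots_finite[OF assms] finite_subset by blast
    then show False
      using infinite_Icc[of "-1::real" 1] by simp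
  qed
  ultimately show ?thesis by simp
qed

section \<open>Orthogonality of Legendre polynomials from Rodrigues' formula\<close>

lemma power_dvd_pderiv:
  fixes q f :: "real poly"
  assumes "q ^ Suc n dvd f"
  shows "q ^ n dvd pderiv f"
proof -
  from assms obtain g where "f = q ^ Suc n * g" by (auto elim: dvdE)
  then have "pderiv f = q ^ n * (q * pderiv g + g * Polynomial.smult (of_nat (Suc n)) (pderiv q))"
    by (simp only: pderiv_mult pderiv_power_Suc) (simp add: algebra_simps)
  then show ?thesis by simp
qed

lemma power_dvd_higher_pderiv:
  fixes q f :: "real poly"
  assumes "q ^ (n + m) dvd f"
  shows "q ^ m dvd (pderiv ^^ n) f"
  using assms
proof (induction n arbitrary: m)
  case (Suc n)
  have "q ^ Suc m dvd (pderiv ^^ n) f"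
    by (rule Suc.IH) (use Suc.prems in simp)
  then show ?case
    using power_dvd_pderiv by simp
qed simp

text \<open>Integration by parts moves the derivatives onto \<open>p\<close> one at a time. The
  boundary terms vanish because fewer than \<open>n\<close> derivatives of \<open>f\<close> leave a
  factor x^2 - 1, and \<open>n\<close> derivatives annihilate \<open>p\<close>. The alternative
  \<open>p = 0\<close> serves the base case \<open>n = 0\<close>, where no degree lies below the
  bound.\<close>

lemma poly_integral_times_higher_pderiv:
  assumes "[:-1, 0, 1:] ^ n dvd f" "degree p < n \<or> p = 0"
  shows "poly_integral (p * (pderiv ^^ n) f) = 0"
  using assms
proof (induction n arbitrary: p)
  case (Suc n)
  let ?h = "(pderiv ^^ n) f"
  have "[:-1, 0, 1:] ^ 1 dvd ?h"
    by (rule power_dvd_higher_pderiv) (use Suc.prems in simp)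
  then obtain k where k: "?h = [:-1, 0, 1:] * k" by (auto elim: dvdE)
  have bdry: "poly ?h 1 = 0" "poly ?h (-1) = 0"
    by (simp_all add: k)
  have deg: "degree (pderiv p) < n \<or> pderiv p = 0"
    using Suc.prems(2) by (cases "degree p = 0") (auto simp: degree_pderiv pderiv_eq_0_iff)
  have "[:-1, 0, 1:] ^ n dvd f"
    using Suc.prems(1) by (meson dvd_trans le_imp_power_dvd lessI less_imp_le)
  then have "poly_integral (pderiv p * ?h) = 0"
    using Suc.IH deg by blast
  moreover have "poly_integral (pderiv (p * ?h)) = 0"
    by (simp add: poly_integral_pderiv bdry)
  ultimately show ?case
    by (simp add: pderiv_mult poly_integral_add mult.commute)
qed auto

lemma legendre_orthogonal:
  assumes "degree p < k"
  shows "poly_integral (p * legendre k) = 0"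
  using poly_integral_times_higher_pderiv[of k "[:-1, 0, 1:] ^ k" p] assms
  by (simp add: legendre_def poly_integral_smult)

lemma degree_higher_pderiv: "degree ((pderiv ^^ n) (p :: real poly)) = degree p - n"
  by (induction n) (auto simp: degree_pderiv)

lemma degree_legendre: "degree (legendre k) = k"
  by (simp add: legendre_def degree_higher_pderiv degree_power_eq)

lemma legendre_nonzero: "legendre k \<noteq> 0"
  using degree_legendre[of k] by (cases "k = 0") (auto simp: legendre_def)

lemma degree_legendre_normalized: "degree (legendre_normalized k) \<le> k"
  using degree_smult_le degree_legendre unfolding legendre_normalized_def by metis

lemma legendre_normalized_orthonormal:
  "poly_integral (legendre_normalized i * legendre_normalized j) = (if i = j then 1 else 0)"
proof (cases "i = j")
  case True
  have *: "integral {-1..1} (\<lambda>x. (poly (legendre j) x)\<^sup>2) = poly_integral (legendre j * legendre j)"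
    by (rule poly_integral_eq[symmetric]) (simp add: power2_eq_square)
  show ?thesis
    using True poly_integral_square_pos[OF legendre_nonzero[of j]]
    by (simp add: legendre_normalized_def * poly_integral_smult)
next
  case False
  then consider "degree (legendre i) < j" | "degree (legendre j) < i"
    unfolding degree_legendre by linarith
  then have "poly_integral (legendre i * legendre j) = 0"
    by cases (metis legendre_orthogonal mult.commute)+
  then show ?thesis
    using False by (simp add: legendre_normalized_def poly_integral_smult)
qed

lemma legendre_normalized_1: "legendre_normalized 1 = [:0, sqrt (3 / 2):]"
proof -
  have l1: "legendre (Suc 0) = [:0, 1:]"
    by (simp add: legendre_def pderiv_pCons numeral_poly)
  have "poly_integral [:0, 0, 1:] = poly_integral (pderiv [:0, 0, 0, 1 / 3:])"
    by (simp add: pderiv_pCons)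
  also have "\<dots> = 2 / 3"
    by (subst poly_integral_pderiv) simp
  also have "poly_integral [:0, 0, 1:] = integral {-1..1} (\<lambda>x. x\<^sup>2)"
    by (rule poly_integral_eq) (simp add: power2_eq_square)
  finally have norm_x: "integral {-1..1::real} (\<lambda>x. x\<^sup>2) = 2 / 3" by simp
  then show ?thesis
    by (simp only: legendre_normalized_def l1 One_nat_def) (simp add: norm_x real_sqrt_divide del: eq_divide_eq_numeral1)
qed

section \<open>Lagrange interpolation and the quadrature rule\<close>

definition lagrange_basis :: "nat \<Rightarrow> (nat \<Rightarrow> real) \<Rightarrow> nat \<Rightarrow> real poly" where
  "lagrange_basis n \<mu> k =
     (\<Prod>j\<in>{..<n} - {k}. Polynomial.smult (1 / (\<mu> k - \<mu> j)) [:- \<mu> j, 1:])"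

lemma poly_lagrange_basis:
  "poly (lagrange_basis n \<mu> k) x = (\<Prod>j\<in>{..<n} - {k}. (x - \<mu> j) / (\<mu> k - \<mu> j))"
  by (simp add: lagrange_basis_def poly_prod diff_divide_distrib)

lemma degree_lagrange_basis:
  assumes "k < n"
  shows "degree (lagrange_basis n \<mu> k) \<le> n - 1"
proof -
  have "degree (lagrange_basis n \<mu> k)
      \<le> (\<Sum>j\<in>{..<n} - {k}. degree (Polynomial.smult (1 / (\<mu> k - \<mu> j)) [:- \<mu> j, 1:]))"
    unfolding lagrange_basis_def using degree_prod_sum_le[OF finite_Diff[OF finite_lessThan]] by (simp only: comp_def)
  also have "\<dots> \<le> (\<Sum>j\<in>{..<n} - {k}. 1)"
    by (intro sum_mono order.trans[OF degree_smult_le]) simp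
  also have "\<dots> = n - 1"
    using assms by simp
  finally show ?thesis .
qed

lemma lagrange_basis_node:
  assumes "inj_on \<mu> {..<n}" "k < n" "j < n"
  shows "poly (lagrange_basis n \<mu> k) (\<mu> j) = (if j = k then 1 else 0)"
proof (cases "j = k")
  case True
  have "\<mu> k \<noteq> \<mu> i" if "i \<in> {..<n} - {k}" for i
    using assms that by (auto dest: inj_onD)
  then show ?thesis
    using True by (simp add: poly_lagrange_basis)
next
  case False
  then show ?thesis
    using assms(3) by (auto simp: poly_lagrange_basis)
qed

lemma poly_zero_of_nodes:
  fixes p :: "real poly"
  assumes "inj_on \<mu> {..<n}" "\<And>k. k < n \<Longrightarrow> poly p (\<mu> k) = 0" "degree p < n"
  shows "p = 0"
proof (rule ccontr)
  assume nz: "p \<noteq> 0"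
  have "n = card (\<mu> ` {..<n})"
    using assms(1) by (simp add: card_image)
  also have "\<dots> \<le> card {x. poly p x = 0}"
    by (rule card_mono) (use poly_roots_finite[OF nz] assms(2) in auto)
  also have "\<dots> \<le> degree p"
    by (rule card_poly_roots_bound[OF nz])
  finally show False using assms(3) by simp
qed

lemma lagrange_interpolation:
  assumes "inj_on \<mu> {..<n}" "degree p < n"
  shows "p = (\<Sum>k<n. Polynomial.smult (poly p (\<mu> k)) (lagrange_basis n \<mu> k))" (is "p = ?q")
proof -
  have "degree ?q \<le> n - 1"
    by (intro degree_sum_le order.trans[OF degree_smult_le] degree_lagrange_basis) auto
  then have "degree (p - ?q) < n"
    using assms(2) by (intro degree_diff_less) auto
  moreover have "poly (p - ?q) (\<mu> j) = 0" if "j < n" for j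
  proof -
    have "poly ?q (\<mu> j) = (\<Sum>k<n. poly p (\<mu> k) * (if j = k then 1 else 0))"
      unfolding poly_sum poly_smult
      by (intro sum.cong refl) (use assms(1) that in \<open>simp add: lagrange_basis_node\<close>)
    also have "\<dots> = (\<Sum>k<n. if k = j then poly p (\<mu> j) else 0)"
      by (intro sum.cong) auto
    finally show ?thesis using that by simp
  qed
  ultimately have "p - ?q = 0"
    by (intro poly_zero_of_nodes[OF assms(1)]) auto
  then show ?thesis by simp
qed

lemma gauss_legendre_weight:
  assumes "gauss_legendre n \<mu> w" "k < n"
  shows "w k = poly_integral (lagrange_basis n \<mu> k)"
  using assms poly_integral_eq[OF poly_lagrange_basis] by (simp add: gauss_legendre_def)

text \<open>Division by \<open>legendre n\<close>: the multiple of \<open>legendre n\<close>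
  integrates to zero by orthogonality, as the quotient has degree below \<open>n\<close>, and it
  vanishes at the nodes. The remainder also has degree below \<open>n\<close>, where interpolation
  is exact.\<close>

lemma gauss_legendre_exact:
  assumes g: "gauss_legendre n \<mu> w" and deg: "degree p < 2 * n"
  shows "poly_integral p = (\<Sum>k<n. w k * poly p (\<mu> k))"
proof -
  let ?L = "legendre n"
  define q where "q = p div ?L"
  define r where "r = p mod ?L"
  have n: "n > 0" using deg by simp
  have inj: "inj_on \<mu> {..<n}" and root: "\<And>k. k < n \<Longrightarrow> poly ?L (\<mu> k) = 0"
    using g by (auto simp: gauss_legendre_def)
  have p: "p = q * ?L + r" by (simp add: q_def r_def)
  have degr: "degree r < n"
    using degree_mod_less[OF legendre_nonzero, of p n] n by (auto simp: degree_legendre r_def)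
  have degq: "degree q < n"
  proof (rule ccontr)
    assume "\<not> degree q < n"
    moreover from this n have "q \<noteq> 0" by auto
    ultimately have "degree (q * ?L) \<ge> 2 * n"
      using n legendre_nonzero[of n] by (auto simp: degree_mult_eq degree_legendre)
    then have "degree p = degree (q * ?L)"
      using degr unfolding p by (intro degree_add_eq_left) linarith
    with \<open>degree (q * ?L) \<ge> 2 * n\<close> deg show False by simp
  qed
  have val: "poly p (\<mu> k) = poly r (\<mu> k)" if "k < n" for k
    using root[OF that] by (simp add: p)
  have "poly_integral p = poly_integral r"
    by (subst p) (simp add: poly_integral_add legendre_orthogonal[OF degq])
  also have "\<dots> = (\<Sum>k<n. poly r (\<mu> k) * poly_integral (lagrange_basis n \<mu> k))"
    by (subst lagrange_interpolation[OF inj degr]) (simp add: poly_integral_sum poly_integral_smult)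
  also have "\<dots> = (\<Sum>k<n. w k * poly p (\<mu> k))"
    by (intro sum.cong refl) (simp add: gauss_legendre_weight[OF g] val)
  finally show ?thesis .
qed

text \<open>The rule is exact for the square of a Lagrange basis polynomial, whose degree is at most
  \<open>2 * (n - 1)\<close>, and only node \<open>k\<close> contributes to the sum. So the weight
  is also the integral of this square.\<close>

lemma gauss_legendre_weight_pos:
  assumes g: "gauss_legendre n \<mu> w" and k: "k < n"
  shows "w k > 0"
proof -
  let ?l = "lagrange_basis n \<mu> k"
  have inj: "inj_on \<mu> {..<n}" using g by (simp add: gauss_legendre_def)
  have "degree (?l * ?l) \<le> degree ?l + degree ?l" by (rule degree_mult_le)
  then have "degree (?l * ?l) < 2 * n"
    using degree_lagrange_basis[OF k, of \<mu>] k by linarith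
  then have "poly_integral (?l * ?l) = (\<Sum>j<n. w j * poly (?l * ?l) (\<mu> j))"
    by (rule gauss_legendre_exact[OF g])
  also have "\<dots> = (\<Sum>j<n. if j = k then w k else 0)"
    by (intro sum.cong refl) (simp add: lagrange_basis_node[OF inj k])
  also have "\<dots> = w k" using k by simp
  finally have "poly_integral (?l * ?l) = w k" .
  moreover have "?l \<noteq> 0"
    using lagrange_basis_node[OF inj k k] by auto
  ultimately show ?thesis using poly_integral_square_pos by metis
qed

lemma gauss_legendre_weight_sum:
  assumes g: "gauss_legendre n \<mu> w" and n: "n > 0"
  shows "(\<Sum>k<n. w k) = 2"
  using gauss_legendre_exact[OF g, of 1] n poly_integral_eq[of 1 "\<lambda>x. 1"] by simp

text \<open>Each entry is the quadrature of a product of two normalized Legendre polynomials. Its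
  degree is at most \<open>2 * Nang p\<close>, within the exactness range of
  \<open>Nang p + 1\<close> nodes, so the sum is their integral. Positive weights are needed to
  multiply the two square roots back to \<open>wt p k\<close>.\<close>

lemma T_mat_orthonormal:
  assumes "gauss_legendre (Nang p + 1) (mu p) (wt p)"
  shows "T_mat p * transpose_mat (T_mat p) = 1\<^sub>m (Nang p)"
proof (rule eq_matI)
  fix i j assume "i < dim_row (1\<^sub>m (Nang p) :: real mat)" "j < dim_col (1\<^sub>m (Nang p) :: real mat)"
  then have ij: "i < Nang p" "j < Nang p" by auto
  let ?q = "legendre_normalized (i + 1) * legendre_normalized (j + 1)"
  have "degree ?q \<le> (i + 1) + (j + 1)"
    by (rule order.trans[OF degree_mult_le]) (intro add_mono degree_legendre_normalized)
  then have "degree ?q < 2 * (Nang p + 1)" using ij by simp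
  then have "poly_integral ?q = (\<Sum>k<Nang p + 1. wt p k * poly ?q (mu p k))"
    by (rule gauss_legendre_exact[OF assms])
  also have "\<dots> = (T_mat p * transpose_mat (T_mat p)) $$ (i, j)"
  proof -
    have "wt p k * poly ?q (mu p k) = T_mat p $$ (i, k) * T_mat p $$ (j, k)" if "k < Nang p + 1" for k
      using ij that gauss_legendre_weight_pos[OF assms, of k] by (simp add: T_mat_def)
    then have "(\<Sum>k<Nang p + 1. wt p k * poly ?q (mu p k)) = (\<Sum>k<Nang p + 1. T_mat p $$ (i, k) * T_mat p $$ (j, k))"
      by (intro sum.cong) auto
    then show ?thesis
      using ij by (simp add: T_mat_def scalar_prod_def atLeast0LessThan del: sum.lessThan_Suc real_sqrt_mult_self mult_eq_0_iff mult_cancel_left)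
  qed
  finally show "(T_mat p * transpose_mat (T_mat p)) $$ (i, j) = (1\<^sub>m (Nang p) :: real mat) $$ (i, j)"
    using ij by (simp add: legendre_normalized_orthonormal)
qed (simp_all add: T_mat_def)

section \<open>Summation by parts on the staggered grid\<close>

lemma iface_val_inside:
  assumes "dim_vec u = num_ifaces b n" "j < num_ifaces b n"
  shows "iface_val b u (int j) = u $ j"
  using assms by (cases b) (auto simp: iface_val_def num_ifaces_def)

text \<open>In the periodic case both indices name the same interface; in the zero case both are
  boundary interfaces with the default value 0. Through this fact the shift arguments below cover
  both boundary conditions at once.\<close>

lemma iface_val_last:
  assumes "dim_vec u = num_ifaces b n" "0 < n"
  shows "iface_val b u (int n - 1) = iface_val b u (-1)"
proof (cases b)
  case Periodic
  have "(int n - 1) mod int n = (-1) mod int n"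
    using mod_add_self1[of "int n" "-1"] by simp
  then show ?thesis
    using assms Periodic by (simp add: iface_val_def num_ifaces_def)
next
  case Zero
  then show ?thesis
    using assms by (auto simp: iface_val_def num_ifaces_def)
qed

lemma sum_shift_periodic:
  fixes \<phi> :: "int \<Rightarrow> real"
  assumes "\<phi> (int n - 1) = \<phi> (-1)"
  shows "(\<Sum>i<n. \<phi> (int i - 1)) = (\<Sum>i<n. \<phi> (int i))"
proof -
  have "(\<Sum>i<n. \<phi> (int i) - \<phi> (int i - 1)) = \<phi> (int n - 1) - \<phi> (-1)"
    using sum_lessThan_telescope[of "\<lambda>i. \<phi> (int i - 1)" n] by (simp add: algebra_simps)
  then show ?thesis
    using assms by (simp add: sum_subtractf)
qed

text \<open>In the zero case the extra index \<open>n - 1\<close> on the right is the right boundary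
  interface, where the value of \<open>u\<close> is 0, so \<open>f\<close> may be arbitrary
  there.\<close>

lemma sum_ifaces_eq_sum_mids:
  assumes "dim_vec u = num_ifaces b n" "0 < n"
  shows "(\<Sum>j<num_ifaces b n. f j * u $ j) = (\<Sum>i<n. f i * iface_val b u (int i))"
proof (cases b)
  case Periodic
  then show ?thesis
    using assms by (intro sum.cong) (auto simp: num_ifaces_def iface_val_def)
next
  case Zero
  define m where "m = n - 1"
  have "n = Suc m" "num_ifaces b n = m"
    using assms(2) Zero by (auto simp: num_ifaces_def m_def)
  then show ?thesis
    using assms Zero by (auto simp: iface_val_def intro!: sum.cong)
qed

text \<open>
  Jumps are indexed by midpoints: in the zero case there is one more of them than interfaces, and
  the jumps at both ends count.
\<close>

definition jump :: "boundary \<Rightarrow> real vec \<Rightarrow> nat \<Rightarrow> real" where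
  "jump b u i = iface_val b u (int i) - iface_val b u (int i - 1)"

lemma sum_backward_diff:
  assumes "dim_vec u = num_ifaces b n" "0 < n"
  shows "(\<Sum>j<num_ifaces b n. (iface_val b w (int j) - iface_val b w (int j - 1)) * u $ j)
       = (\<Sum>i<n. jump b w i * iface_val b u (int i))"
  unfolding jump_def by (rule sum_ifaces_eq_sum_mids[OF assms])

lemma sum_forward_diff:
  assumes u: "dim_vec u = num_ifaces b n" and w: "dim_vec w = num_ifaces b n" and n: "0 < n"
  shows "(\<Sum>j<num_ifaces b n. (iface_val b w (int j + 1) - iface_val b w (int j)) * u $ j)
       = (\<Sum>i<n. jump b w i * iface_val b u (int i - 1))"
proof -
  \<comment> \<open>Only the product has to agree at the two ends. In the zero case the differences
    of \<open>w\<close> there may be distinct, but the factor \<open>u\<close> vanishes.\<close>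
  let ?\<phi> = "\<lambda>i. (iface_val b w (i + 1) - iface_val b w i) * iface_val b u i"
  have "?\<phi> (int n - 1) = ?\<phi> (-1)"
  proof (cases b)
    case Periodic
    then have "iface_val b w (int n) = iface_val b w 0"
      using w by (simp add: iface_val_def num_ifaces_def)
    then show ?thesis
      using iface_val_last[OF u n] iface_val_last[OF w n] by simp
  next
    case Zero
    then have "iface_val b u (int n - 1) = 0" "iface_val b u (-1) = 0"
      using u n by (auto simp: iface_val_def num_ifaces_def)
    then show ?thesis by simp
  qed
  then have "(\<Sum>i<n. ?\<phi> (int i - 1)) = (\<Sum>i<n. ?\<phi> (int i))"
    by (rule sum_shift_periodic)
  then show ?thesis
    by (simp add: sum_ifaces_eq_sum_mids[OF u n] jump_def)
qed

text \<open>Up to the factor \<open>dx\<close>, this says that \<open>delta0\<close> and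
  \<open>D0\<close> are negative adjoints of each other, the source of the cancellation between the
  moments and the macroscopic quantities.\<close>

lemma sum_by_parts_mids:
  assumes u: "dim_vec u = num_ifaces b n" and n: "0 < n"
  shows "(\<Sum>j<num_ifaces b n. (B ((j + 1) mod n) - B j) * u $ j) = - (\<Sum>i<n. jump b u i * B i)"
proof -
  let ?\<phi> = "\<lambda>i. iface_val b u i * B (nat ((i + 1) mod int n))"
  have "(\<Sum>i<n. ?\<phi> (int i - 1)) = (\<Sum>i<n. ?\<phi> (int i))"
    by (rule sum_shift_periodic) (simp add: iface_val_last[OF u n])
  also have "(\<Sum>i<n. ?\<phi> (int i)) = (\<Sum>i<n. iface_val b u (int i) * B ((i + 1) mod n))"
    by (intro sum.cong refl) (simp add: nat_mod_distrib nat_add_distrib)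
  finally have "(\<Sum>i<n. iface_val b u (int i) * B ((i + 1) mod n))
      = (\<Sum>i<n. iface_val b u (int i - 1) * B i)"
    by simp
  then show ?thesis
    unfolding sum_ifaces_eq_sum_mids[OF u n] jump_def
    by (simp add: algebra_simps sum_subtractf)
qed

lemma sum_iface_prev_square:
  assumes u: "dim_vec u = num_ifaces b n" and n: "0 < n"
  shows "(\<Sum>i<n. (iface_val b u (int i - 1))\<^sup>2) = (\<Sum>i<n. (iface_val b u (int i))\<^sup>2)"
  by (rule sum_shift_periodic) (simp add: iface_val_last[OF u n])

lemma sum_iface_square:
  assumes u: "dim_vec u = num_ifaces b n" and n: "0 < n"
  shows "(\<Sum>i<n. (iface_val b u (int i))\<^sup>2) = (\<Sum>j<num_ifaces b n. (u $ j)\<^sup>2)"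
proof -
  have "(\<Sum>j<num_ifaces b n. (u $ j)\<^sup>2)
      = (\<Sum>j<num_ifaces b n. iface_val b u (int j) * u $ j)"
    by (intro sum.cong refl) (simp add: iface_val_inside[OF u] power2_eq_square)
  then show ?thesis
    by (simp add: sum_ifaces_eq_sum_mids[OF u n] power2_eq_square)
qed

text \<open>Each interface value enters two jumps, and (x - y)^2 \<le> 2 x^2 + 2 y^2. The constant 4
  is why absorption later counts as \<open>sigma0 p / 4\<close> per squared jump.\<close>

lemma sum_jump_square_le:
  assumes u: "dim_vec u = num_ifaces b n" and n: "0 < n"
  shows "(\<Sum>i<n. (jump b u i)\<^sup>2) \<le> 4 * (\<Sum>j<num_ifaces b n. (u $ j)\<^sup>2)"
proof -
  have "(x - y)\<^sup>2 \<le> 2 * x\<^sup>2 + 2 * y\<^sup>2" for x y :: real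
    using sum_squares_bound[of x "- y"] by (simp add: power2_diff)
  then have "(\<Sum>i<n. (jump b u i)\<^sup>2)
      \<le> (\<Sum>i<n. 2 * (iface_val b u (int i))\<^sup>2 + 2 * (iface_val b u (int i - 1))\<^sup>2)"
    unfolding jump_def by (intro sum_mono)
  also have "\<dots> = 4 * (\<Sum>j<num_ifaces b n. (u $ j)\<^sup>2)"
    by (simp add: sum.distrib sum_distrib_left[symmetric] sum_iface_prev_square[OF u n]
        sum_iface_square[OF u n])
  finally show ?thesis .
qed

lemma iface_val_minus:
  assumes "dim_vec u = num_ifaces b n" "dim_vec w = num_ifaces b n" "0 < n"
  shows "iface_val b (u - w) j = iface_val b u j - iface_val b w j"
proof (cases b)
  case Periodic
  have "j mod int n < int n" "0 \<le> j mod int n" using assms(3) by auto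
  then have "nat (j mod int n) < n" by linarith
  then show ?thesis
    using Periodic assms by (simp add: iface_val_def num_ifaces_def)
next
  case Zero
  then show ?thesis
    using assms by (auto simp: iface_val_def num_ifaces_def nat_less_iff)
qed

lemma jump_minus:
  assumes "dim_vec u = num_ifaces b n" "dim_vec w = num_ifaces b n" "0 < n"
  shows "jump b (u - w) i = jump b u i - jump b w i"
  by (simp add: jump_def iface_val_minus[OF assms])

text \<open>From (x - y) x = ((x - y)^2 + x^2 - y^2) / 2, where the sums of x^2 and y^2 cancel under
  the shift by one interface. The opposite signs for the two sides make upwinding
  dissipative.\<close>

lemma sum_jump_self:
  assumes u: "dim_vec u = num_ifaces b n" and n: "0 < n"
  shows "(\<Sum>i<n. jump b u i * iface_val b u (int i)) = (\<Sum>i<n. (jump b u i)\<^sup>2) / 2"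
    and "(\<Sum>i<n. jump b u i * iface_val b u (int i - 1)) = - (\<Sum>i<n. (jump b u i)\<^sup>2) / 2"
proof -
  let ?U = "\<lambda>i::nat. iface_val b u (int i)" and ?P = "\<lambda>i::nat. iface_val b u (int i - 1)"
  have "2 * (\<Sum>i<n. jump b u i * ?U i)
      = (\<Sum>i<n. (jump b u i)\<^sup>2 + (?U i)\<^sup>2 - (?P i)\<^sup>2)"
    unfolding sum_distrib_left jump_def
    by (intro sum.cong refl) (simp add: power2_eq_square algebra_simps)
  then show "(\<Sum>i<n. jump b u i * ?U i) = (\<Sum>i<n. (jump b u i)\<^sup>2) / 2"
    by (simp add: sum.distrib sum_subtractf sum_iface_prev_square[OF u n])
  have "2 * (\<Sum>i<n. jump b u i * ?P i)
      = (\<Sum>i<n. (?U i)\<^sup>2 - (?P i)\<^sup>2 - (jump b u i)\<^sup>2)"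
    unfolding sum_distrib_left jump_def
    by (intro sum.cong refl) (simp add: power2_eq_square algebra_simps)
  then show "(\<Sum>i<n. jump b u i * ?P i) = - (\<Sum>i<n. (jump b u i)\<^sup>2) / 2"
    by (simp add: sum_subtractf sum_iface_prev_square[OF u n])
qed

text \<open>Summation by parts takes the jump off the increment \<open>e\<close>, so that Young's
  inequality involves only values of \<open>e\<close> and jumps of \<open>u\<close>.\<close>

lemma sum_jump_swap:
  assumes u: "dim_vec u = num_ifaces b n" and e: "dim_vec e = num_ifaces b n" and n: "0 < n"
  shows "(\<Sum>i<n. jump b e i * iface_val b u (int i))
       = - (\<Sum>i<n. iface_val b e (int i - 1) * jump b u i)"
    and "(\<Sum>i<n. jump b e i * iface_val b u (int i - 1))
       = - (\<Sum>i<n. iface_val b e (int i) * jump b u i)"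
proof -
  have "(\<Sum>i<n. iface_val b e (int i - 1) * iface_val b u (int i - 1))
      = (\<Sum>i<n. iface_val b e (int i) * iface_val b u (int i))"
    by (rule sum_shift_periodic) (simp add: iface_val_last[OF u n] iface_val_last[OF e n])
  then show "(\<Sum>i<n. jump b e i * iface_val b u (int i))
       = - (\<Sum>i<n. iface_val b e (int i - 1) * jump b u i)"
    and "(\<Sum>i<n. jump b e i * iface_val b u (int i - 1))
       = - (\<Sum>i<n. iface_val b e (int i) * jump b u i)"
    by (simp_all add: jump_def algebra_simps sum_subtractf)
qed

text \<open>The difference of the two sides is a sum of terms (2 l x - m y)^2 / (4 l). The weight
  \<open>l\<close> stays free until it can be matched with the squared time increment.\<close>

lemma young_sum:
  fixes f g :: "nat \<Rightarrow> real"
  assumes "0 < l"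
  shows "m * (\<Sum>i<n. f i * g i) \<le> l * (\<Sum>i<n. (f i)\<^sup>2) + m\<^sup>2 / (4 * l) * (\<Sum>i<n. (g i)\<^sup>2)"
proof -
  have "m * (x * y) \<le> l * x\<^sup>2 + m\<^sup>2 / (4 * l) * y\<^sup>2" for x y :: real
  proof -
    have "0 \<le> (2 * l * x - m * y)\<^sup>2 / (4 * l)" using assms by simp
    also have "\<dots> = l * x\<^sup>2 + m\<^sup>2 / (4 * l) * y\<^sup>2 - m * (x * y)"
      using assms by (simp add: power2_eq_square field_simps)
    finally show ?thesis by simp
  qed
  then have "(\<Sum>i<n. m * (f i * g i)) \<le> (\<Sum>i<n. l * (f i)\<^sup>2 + m\<^sup>2 / (4 * l) * (g i)\<^sup>2)"
    by (intro sum_mono)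
  then show ?thesis
    by (simp add: sum_distrib_left sum.distrib)
qed

text \<open>
  Upwinding the old value \<open>w\<close> and testing with the new value \<open>u\<close>: the part with \<open>u\<close> itself
  dissipates, and the remainder is absorbed by the implicit Euler increment \<open>u - w\<close>.
\<close>

lemma upwind_estimate:
  assumes u: "dim_vec u = num_ifaces b n" and w: "dim_vec w = num_ifaces b n" and n: "0 < n"
    and l: "0 < l"
  shows "- (max m 0 * (\<Sum>i<n. jump b w i * iface_val b u (int i))
          + min m 0 * (\<Sum>i<n. jump b w i * iface_val b u (int i - 1)))
    \<le> l * (\<Sum>j<num_ifaces b n. ((u - w) $ j)\<^sup>2) + (m\<^sup>2 / (4 * l) - \<bar>m\<bar> / 2) * (\<Sum>i<n. (jump b u i)\<^sup>2)"
proof -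
  define e where "e = u - w"
  have e: "dim_vec e = num_ifaces b n" using u w by (simp add: e_def)
  have jw: "jump b w i = jump b u i - jump b e i" for i
    by (simp add: e_def jump_minus[OF u w n])
  let ?J = "\<Sum>i<n. (jump b u i)\<^sup>2"
  have E: "(\<Sum>i<n. (iface_val b e (int i))\<^sup>2) = (\<Sum>j<num_ifaces b n. (e $ j)\<^sup>2)"
    by (rule sum_iface_square[OF e n])
  have 1: "(\<Sum>i<n. jump b w i * iface_val b u (int i))
      = ?J / 2 + (\<Sum>i<n. iface_val b e (int i - 1) * jump b u i)"
    by (simp add: jw left_diff_distrib sum_subtractf sum_jump_self[OF u n] sum_jump_swap[OF u e n])
  have 2: "(\<Sum>i<n. jump b w i * iface_val b u (int i - 1))
      = - ?J / 2 + (\<Sum>i<n. iface_val b e (int i) * jump b u i)"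
    by (simp add: jw left_diff_distrib sum_subtractf sum_jump_self[OF u n] sum_jump_swap[OF u e n])
  \<comment> \<open>The sign of \<open>m\<close> leaves one of the two one-sided sums, and its part
    with \<open>u\<close> alone gives \<open>\<bar>m\<bar> / 2\<close> with the dissipative sign in
    either case.\<close>
  show ?thesis
  proof (cases "m \<ge> 0")
    case True
    have "(- m) * (\<Sum>i<n. iface_val b e (int i - 1) * jump b u i)
        \<le> l * (\<Sum>j<num_ifaces b n. (e $ j)\<^sup>2) + m\<^sup>2 / (4 * l) * ?J"
      using young_sum[OF l, of "- m" "\<lambda>i. iface_val b e (int i - 1)" "jump b u" n]
      by (simp add: sum_iface_prev_square[OF e n] E)
    then show ?thesis
      using True by (simp add: 1 e_def[symmetric] algebra_simps)
  next
    case False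
    have "(- m) * (\<Sum>i<n. iface_val b e (int i) * jump b u i)
        \<le> l * (\<Sum>j<num_ifaces b n. (e $ j)\<^sup>2) + m\<^sup>2 / (4 * l) * ?J"
      using young_sum[OF l, of "- m" "\<lambda>i. iface_val b e (int i)" "jump b u" n]
      by (simp add: E)
    then show ?thesis
      using False by (simp add: 2 e_def[symmetric] algebra_simps)
  qed
qed

section \<open>Frobenius inner product and the tested Galerkin step\<close>

definition frob :: "real mat \<Rightarrow> real mat \<Rightarrow> real" where
  "frob A B = (\<Sum>i<dim_row A. \<Sum>j<dim_col A. A $$ (i, j) * B $$ (i, j))"

lemma frobenius_norm_square: "(frobenius_norm A)\<^sup>2 = frob A A"
  by (simp add: frobenius_norm_def frob_def power2_eq_square sum_nonneg)

lemma frob_nonneg: "0 \<le> frob A A"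
  by (simp add: frob_def sum_nonneg)

lemma frob_commute: "dim_row A = dim_row B \<Longrightarrow> dim_col A = dim_col B \<Longrightarrow> frob A B = frob B A"
  by (simp add: frob_def mult.commute)

lemma frob_add_left:
  "dim_row A = dim_row B \<Longrightarrow> dim_col A = dim_col B \<Longrightarrow> frob (A + B) C = frob A C + frob B C"
  by (simp add: frob_def algebra_simps sum.distrib)

lemma frob_minus_left:
  "dim_row A = dim_row B \<Longrightarrow> dim_col A = dim_col B \<Longrightarrow> frob (A - B) C = frob A C - frob B C"
  by (simp add: frob_def algebra_simps sum_subtractf)

lemma frob_smult_left: "frob (c \<cdot>\<^sub>m A) C = c * frob A C"
  by (simp add: frob_def algebra_simps sum_distrib_left)

lemma frob_transpose:
  "dim_row A = dim_row B \<Longrightarrow> dim_col A = dim_col B \<Longrightarrow>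
    frob (transpose_mat A) (transpose_mat B) = frob A B"
  unfolding frob_def by (subst sum.swap) simp

lemma mat_assoc:
  fixes A B C :: "real mat"
  assumes "dim_col A = dim_row B" "dim_col B = dim_row C"
  shows "A * B * C = A * (B * C)"
  using assms by (intro assoc_mult_mat[of _ "dim_row A" "dim_row B" _ "dim_row C" _ "dim_col C"]) auto

lemma transpose_mult_dim:
  fixes A B :: "real mat"
  assumes "dim_col A = dim_row B"
  shows "transpose_mat (A * B) = transpose_mat B * transpose_mat A"
  using assms by (intro transpose_mult[of _ "dim_row A" "dim_row B" _ "dim_col B"]) auto

lemma frob_mult_left:
  assumes "dim_col A = dim_row B" "dim_row C = dim_row A" "dim_col C = dim_col B"
  shows "frob (A * B) C = frob B (transpose_mat A * C)"
proof -
  have "frob (A * B) C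
      = (\<Sum>i<dim_row A. \<Sum>j<dim_col B. \<Sum>k<dim_row B. A $$ (i, k) * B $$ (k, j) * C $$ (i, j))"
    using assms by (simp add: frob_def scalar_prod_def atLeast0LessThan sum_distrib_right)
  also have "\<dots> = (\<Sum>k<dim_row B. \<Sum>j<dim_col B. \<Sum>i<dim_row A. A $$ (i, k) * B $$ (k, j) * C $$ (i, j))"
    by (subst (2) sum.swap, subst sum.swap, subst (2) sum.swap) (rule refl)
  also have "\<dots> = frob B (transpose_mat A * C)"
    using assms
    by (auto simp: frob_def scalar_prod_def atLeast0LessThan sum_distrib_left mult_ac intro!: sum.cong)
  finally show ?thesis .
qed

lemma frob_mult_right:
  assumes "dim_col A = dim_row B" "dim_row C = dim_row A" "dim_col C = dim_col B"
  shows "frob (A * B) C = frob A (C * transpose_mat B)"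
proof -
  have "frob (A * B) C = frob (transpose_mat B * transpose_mat A) (transpose_mat C)"
    using assms frob_transpose[of "A * B" C] by (simp add: transpose_mult_dim)
  also have "\<dots> = frob (transpose_mat A) (B * transpose_mat C)"
    using assms by (subst frob_mult_left) auto
  also have "\<dots> = frob A (C * transpose_mat B)"
    using assms frob_transpose[of A "C * transpose_mat B"] by (simp add: transpose_mult_dim)
  finally show ?thesis .
qed

text \<open>The terms of the Galerkin equation are full-space matrices \<open>W\<close> projected
  from both sides; adjointness lifts the test matrix \<open>S\<close> to the full space
  instead.\<close>

lemma frob_conj:
  assumes "dim_row W = dim_row P" "dim_col W = dim_row Q"
    and "dim_row S = dim_col P" "dim_col S = dim_col Q"
  shows "frob (transpose_mat P * W * Q) S = frob W (P * S * transpose_mat Q)"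
proof -
  have "frob (transpose_mat P * W * Q) S = frob (transpose_mat P * W) (S * transpose_mat Q)"
    using assms by (intro frob_mult_right) auto
  also have "\<dots> = frob W (P * (S * transpose_mat Q))"
    using assms frob_mult_left[of "transpose_mat P" W "S * transpose_mat Q"] by simp
  finally show ?thesis
    using assms by (simp add: mat_assoc)
qed

lemma orthonormal_cols_cancel:
  assumes "orthonormal_cols Q" "dim_row A = dim_col Q"
  shows "transpose_mat Q * (Q * A) = A"
proof -
  have "transpose_mat Q * (Q * A) = transpose_mat Q * Q * A"
    using assms by (simp add: mat_assoc)
  also have "\<dots> = A"
    using assms by (simp add: orthonormal_cols_def left_mult_one_mat')
  finally show ?thesis .
qed

lemma frob_isometry_left:
  assumes "orthonormal_cols Q" "dim_row A = dim_col Q" "dim_row B = dim_col Q" "dim_col A = dim_col B"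
  shows "frob (Q * A) (Q * B) = frob A B"
  using assms by (simp add: frob_mult_left orthonormal_cols_cancel)

lemma frob_isometry_right:
  assumes "orthonormal_cols Q" "dim_col A = dim_col Q" "dim_col B = dim_col Q" "dim_row A = dim_row B"
  shows "frob (A * transpose_mat Q) (B * transpose_mat Q) = frob A B"
proof -
  have "frob (A * transpose_mat Q) (B * transpose_mat Q) = frob (Q * transpose_mat A) (Q * transpose_mat B)"
    using assms frob_transpose[of "A * transpose_mat Q" "B * transpose_mat Q"]
    by (simp add: transpose_mult_dim)
  also have "\<dots> = frob A B"
    using assms frob_transpose[of A B] by (simp add: frob_isometry_left)
  finally show ?thesis .
qed

text \<open>Pythagoras: \<open>A\<close> splits orthogonally into its projection and the rest
  \<open>A - ?P\<close>, because the projection has the same inner product with \<open>A\<close> as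
  with itself.\<close>

lemma frob_projection_le:
  assumes Q: "orthonormal_cols Q" and A: "dim_col A = dim_row Q"
  shows "frob (A * Q * transpose_mat Q) (A * Q * transpose_mat Q) \<le> frob A A"
proof -
  let ?P = "A * Q * transpose_mat Q"
  have PA: "frob ?P A = frob (A * Q) (A * Q)"
    using A by (subst frob_mult_right) auto
  have PP: "frob ?P ?P = frob (A * Q) (A * Q)"
    using Q A by (subst frob_isometry_right) auto
  have "frob (A - ?P) (A - ?P) = frob A A - frob ?P ?P"
    using A PA PP
    by (simp add: frob_minus_left frob_commute[of A "A - ?P"] frob_commute[of ?P "A - ?P"]
        frob_commute[of A ?P])
  then show ?thesis
    using frob_nonneg[of "A - ?P"] by simp
qed

text \<open>Such an \<open>X\<close> factors as \<open>Q * Y\<close>, and the inner product of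
  \<open>Q\<close> with itself cancels. Applied to both augmented bases, it shows that re-expanding
  the old solution in them loses nothing.\<close>

lemma projection_fixes:
  assumes Q: "orthonormal_cols Q" and X: "dim_row X = dim_row Q" "set (cols X) \<subseteq> col_range Q"
  shows "Q * (transpose_mat Q * X) = X"
proof -
  have "col X j \<in> col_range Q" if "j < dim_col X" for j
    using X(2) that by (auto simp: cols_def)
  then have "\<forall>j<dim_col X. \<exists>y. y \<in> carrier_vec (dim_col Q) \<and> col X j = Q *\<^sub>v y"
    unfolding col_range_def by blast
  then obtain y where y: "\<And>j. j < dim_col X \<Longrightarrow> y j \<in> carrier_vec (dim_col Q) \<and> col X j = Q *\<^sub>v y j"
    by metis
  define Y where "Y = mat (dim_col Q) (dim_col X) (\<lambda>(i, j). y j $ i)"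
  have "X = Q * Y"
  proof (rule eq_matI)
    fix i j assume ij: "i < dim_row (Q * Y)" "j < dim_col (Q * Y)"
    then have "col Y j = y j"
      using y[of j] by (auto simp: Y_def)
    moreover have "X $$ (i, j) = (Q *\<^sub>v y j) $ i"
      using y[of j] ij X(1) by (simp add: Y_def index_col[symmetric])
    ultimately show "X $$ (i, j) = (Q * Y) $$ (i, j)"
      using ij by simp
  qed (use X(1) in \<open>auto simp: Y_def\<close>)
  then show ?thesis
    using orthonormal_cols_cancel[OF Q, of Y] by (simp add: Y_def)
qed

lemma iface_val_col_mult:
  assumes "dim_col G = dim_row M" "l < dim_col M" "0 < dim_row G"
  shows "iface_val b (col (G * M) l) j = (\<Sum>k<dim_row M. iface_val b (col G k) j * M $$ (k, l))"
proof (cases b)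
  case Periodic
  have "j mod int (dim_row G) < int (dim_row G)" "0 \<le> j mod int (dim_row G)"
    using assms(3) by auto
  then have "nat (j mod int (dim_row G)) < dim_row G" by linarith
  then show ?thesis
    using assms Periodic by (simp add: iface_val_def scalar_prod_def atLeast0LessThan)
next
  case Zero
  then show ?thesis
    using assms by (auto simp: iface_val_def scalar_prod_def atLeast0LessThan nat_less_iff)
qed

section \<open>From the coefficient equation to a balance in the full space\<close>

lemma dim_Dminus [simp]: "dim_row (Dminus p G) = dim_row G" "dim_col (Dminus p G) = dim_col G"
  by (simp_all add: Dminus_def)

lemma dim_Dplus [simp]: "dim_row (Dplus p G) = dim_row G" "dim_col (Dplus p G) = dim_col G"
  by (simp_all add: Dplus_def)

text \<open>Differences combine rows and a right factor combines columns. This turns differences of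
  the basis \<open>Xh\<close> into differences of \<open>g\<close>, and later those of
  \<open>g\<close> into differences of its nodal values.\<close>

lemma Dminus_mult:
  assumes "dim_col G = dim_row M"
  shows "Dminus p (G * M) = Dminus p G * M"
proof (rule eq_matI)
  fix j l assume "j < dim_row (Dminus p G * M)" "l < dim_col (Dminus p G * M)"
  then have "j < dim_row G" "l < dim_col M" by auto
  moreover from this have "0 < dim_row G" by simp
  ultimately show "Dminus p (G * M) $$ (j, l) = (Dminus p G * M) $$ (j, l)"
    using assms
    by (simp add: Dminus_def iface_val_col_mult scalar_prod_def atLeast0LessThan
        sum_subtractf[symmetric] left_diff_distrib sum_divide_distrib diff_divide_distrib)
qed (simp_all)

lemma Dplus_mult:
  assumes "dim_col G = dim_row M"
  shows "Dplus p (G * M) = Dplus p G * M"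
proof (rule eq_matI)
  fix j l assume "j < dim_row (Dplus p G * M)" "l < dim_col (Dplus p G * M)"
  then have "j < dim_row G" "l < dim_col M" by auto
  moreover from this have "0 < dim_row G" by simp
  ultimately show "Dplus p (G * M) $$ (j, l) = (Dplus p G * M) $$ (j, l)"
    using assms
    by (simp add: Dplus_def iface_val_col_mult scalar_prod_def atLeast0LessThan
        sum_subtractf[symmetric] left_diff_distrib sum_divide_distrib diff_divide_distrib)
qed (simp_all)

lemma outer_prod_mult:
  assumes "dim_row P = dim_vec u" "dim_row Q = dim_vec v"
  shows "outer_prod (transpose_mat P *\<^sub>v u) (transpose_mat Q *\<^sub>v v)
       = transpose_mat P * outer_prod u v * Q"
proof (rule eq_matI)
  fix i j assume "i < dim_row (transpose_mat P * outer_prod u v * Q)"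
    "j < dim_col (transpose_mat P * outer_prod u v * Q)"
  then have ij: "i < dim_col P" "j < dim_col Q" by auto
  have "(transpose_mat P * outer_prod u v * Q) $$ (i, j)
      = (\<Sum>l<dim_vec v. \<Sum>k<dim_vec u. P $$ (k, i) * (u $ k * v $ l) * Q $$ (l, j))"
    using ij assms by (simp add: outer_prod_def scalar_prod_def atLeast0LessThan sum_distrib_right)
  also have "\<dots> = (\<Sum>k<dim_vec u. P $$ (k, i) * u $ k) * (\<Sum>l<dim_vec v. Q $$ (l, j) * v $ l)"
    unfolding sum_product by (subst sum.swap) (simp add: mult_ac)
  also have "\<dots> = outer_prod (transpose_mat P *\<^sub>v u) (transpose_mat Q *\<^sub>v v) $$ (i, j)"
    using ij assms by (simp add: outer_prod_def scalar_prod_def atLeast0LessThan)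
  finally show "outer_prod (transpose_mat P *\<^sub>v u) (transpose_mat Q *\<^sub>v v) $$ (i, j)
      = (transpose_mat P * outer_prod u v * Q) $$ (i, j)" by simp
qed (simp_all add: outer_prod_def)

lemma dim_A [simp]:
  "dim_row (A_plus p) = Nang p" "dim_col (A_plus p) = Nang p"
  "dim_row (A_minus p) = Nang p" "dim_col (A_minus p) = Nang p"
  by (simp_all add: A_plus_def A_minus_def T_mat_def)

lemma dim_outer_prod [simp]: "dim_row (outer_prod u v) = dim_vec u" "dim_col (outer_prod u v) = dim_vec v"
  by (simp_all add: outer_prod_def)

lemma dim_mat_diag [simp]: "dim_row (mat_diag n f) = n" "dim_col (mat_diag n f) = n"
  by (simp_all add: mat_diag_def)

lemma dim_s_vec [simp]: "dim_vec (s_vec p h T) = nJ p"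
  by (simp add: s_vec_def delta0_def)

lemma dim_b_vec [simp]: "dim_vec (b_vec p) = Nang p"
  by (simp add: b_vec_def)

text \<open>Although \<open>gh\<close> need not solve the full-rank equation, it lies in the trial
  space of the projected one. Hence testing with \<open>Sh\<close> gives the same inner products as
  testing the full-rank equation with \<open>gh\<close>.\<close>

lemma galerkin_tested:
  fixes p :: bug_params
  assumes X: "X \<in> carrier_mat (nJ p) r" and S: "S \<in> carrier_mat r r" and V: "V \<in> carrier_mat (Nang p) r"
    and Xh: "Xh \<in> carrier_mat (nJ p) q" "orthonormal_cols Xh" "set (cols X) \<subseteq> col_range Xh"
    and Vh: "Vh \<in> carrier_mat (Nang p) q" "orthonormal_cols Vh" "set (cols V) \<subseteq> col_range Vh"
    and step: "galerkin_step p X S V h T Xh Vh Sh"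
  defines "g \<equiv> X * S * transpose_mat V" and "gh \<equiv> Xh * Sh * transpose_mat Vh"
  shows "(eps p)\<^sup>2 / light p / dt p * frob (gh - g) gh =
      - eps p * (frob (Dminus p g * A_plus p) gh + frob (Dplus p g * A_minus p) gh)
      - frob (outer_prod (s_vec p h T) (b_vec p)) gh
      - frob (mat_diag (nJ p) (sigma_iface p) * gh) gh"
proof -
  define St where "St = transpose_mat Xh * X * S * transpose_mat V * Vh"
  define a where "a = (eps p)\<^sup>2 / light p / dt p"
  have Sh: "Sh \<in> carrier_mat q q"
    and eq: "a \<cdot>\<^sub>m (Sh - St) = (- eps p) \<cdot>\<^sub>m LS p Xh Vh St
          - outer_prod (transpose_mat Xh *\<^sub>v s_vec p h T) (transpose_mat Vh *\<^sub>v b_vec p)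
          - sigma_gram p Xh * Sh"
    using step Xh(1) Vh(1) unfolding galerkin_step_def Let_def St_def a_def by auto
  note dims [simp] = carrier_matD[OF X] carrier_matD[OF S] carrier_matD[OF V]
    carrier_matD[OF Xh(1)] carrier_matD[OF Vh(1)] carrier_matD[OF Sh]
  have dSt [simp]: "dim_row St = q" "dim_col St = q"
    by (simp_all add: St_def)
  have dg [simp]: "dim_row g = nJ p" "dim_col g = Nang p" "dim_row gh = nJ p" "dim_col gh = Nang p"
    by (simp_all add: g_def gh_def)
  have PX: "Xh * (transpose_mat Xh * X) = X"
    by (rule projection_fixes) (use Xh in auto)
  have "Vh * (transpose_mat Vh * V) = V"
    by (rule projection_fixes) (use Vh in auto)
  then have "transpose_mat (Vh * (transpose_mat Vh * V)) = transpose_mat V"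
    by simp
  then have PV: "transpose_mat V * (Vh * transpose_mat Vh) = transpose_mat V"
    by (simp add: transpose_mult_dim mat_assoc)
  \<comment> \<open>The projected initial value lifts back to \<open>g\<close> itself, since both
    augmented ranges contain the old ones.\<close>
  have "Xh * St * transpose_mat Vh
      = (Xh * (transpose_mat Xh * X)) * (S * (transpose_mat V * (Vh * transpose_mat Vh)))"
    by (simp add: St_def mat_assoc)
  also have "\<dots> = g"
    by (simp only: PX PV) (simp add: g_def mat_assoc)
  finally have St: "Xh * St * transpose_mat Vh = g" .
  have Stc: "St \<in> carrier_mat q q"
    by (rule carrier_matI) simp_all
  have diff: "Xh * (Sh - St) * transpose_mat Vh = gh - g"
  proof -
    have "Xh * (Sh - St) = Xh * Sh - Xh * St"
      by (rule mult_minus_distrib_mat[OF Xh(1) Sh Stc])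
    moreover have "(Xh * Sh - Xh * St) * transpose_mat Vh = Xh * Sh * transpose_mat Vh - Xh * St * transpose_mat Vh"
      by (rule minus_mult_distrib_mat[of _ "nJ p" q]) (rule carrier_matI; simp)+
    ultimately show ?thesis
      by (simp add: gh_def St)
  qed
  have "frob (Xh * (Sh - St) * transpose_mat Vh) (Xh * Sh * transpose_mat Vh) = frob (Sh - St) Sh"
    by (simp add: frob_isometry_right frob_isometry_left Xh(2) Vh(2))
  then have "a * frob (gh - g) gh = a * frob (Sh - St) Sh"
    by (simp only: diff gh_def[symmetric])
  also have "\<dots> = frob (a \<cdot>\<^sub>m (Sh - St)) Sh"
    by (simp add: frob_smult_left)
  also have "\<dots> = - eps p * frob (LS p Xh Vh St) Sh
      - frob (outer_prod (transpose_mat Xh *\<^sub>v s_vec p h T) (transpose_mat Vh *\<^sub>v b_vec p)) Sh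
      - frob (sigma_gram p Xh * Sh) Sh"
    unfolding eq by (simp add: frob_minus_left frob_smult_left LS_def sigma_gram_def)
  also have "frob (LS p Xh Vh St) Sh
      = frob (Dminus p g * A_plus p) gh + frob (Dplus p g * A_minus p) gh"
  proof -
    have "LS p Xh Vh St = transpose_mat Xh * (Dminus p g * A_plus p) * Vh
        + transpose_mat Xh * (Dplus p g * A_minus p) * Vh"
      unfolding LS_def St[symmetric] by (simp add: Dminus_mult Dplus_mult mat_assoc)
    then show ?thesis
      by (simp add: frob_add_left frob_conj gh_def)
  qed
  also have "frob (outer_prod (transpose_mat Xh *\<^sub>v s_vec p h T) (transpose_mat Vh *\<^sub>v b_vec p)) Sh
      = frob (outer_prod (s_vec p h T) (b_vec p)) gh"
    by (simp add: outer_prod_mult frob_conj gh_def)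
  also have "frob (sigma_gram p Xh * Sh) Sh = frob (mat_diag (nJ p) (sigma_iface p) * gh) gh"
  proof -
    \<comment> \<open>The absorption term carries no angular factor; inserting this identity gives
      it the projected form that \<open>frob_conj\<close> expects.\<close>
    have "transpose_mat Vh * Vh = 1\<^sub>m q"
      using Vh(2) by (simp add: orthonormal_cols_def)
    then have "sigma_gram p Xh * Sh
        = transpose_mat Xh * (mat_diag (nJ p) (sigma_iface p) * gh) * Vh"
      by (simp add: sigma_gram_def gh_def mat_assoc right_mult_one_mat')
    then show ?thesis
      by (simp add: frob_conj gh_def)
  qed
  finally show ?thesis
    by (simp add: a_def)
qed

section \<open>Truncation\<close>

lemma dim_first_cols [simp]:
  "dim_row (first_cols k A) = dim_row A" "dim_col (first_cols k A) = min k (dim_col A)"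
  by (simp_all add: first_cols_def)

lemma dim_drop_cols [simp]:
  "dim_row (drop_cols k A) = dim_row A" "dim_col (drop_cols k A) = dim_col A - k"
  by (simp_all add: drop_cols_def)

lemma dim_hcat [simp]:
  "dim_row (hcat A B) = dim_row A" "dim_col (hcat A B) = dim_col A + dim_col B"
  by (simp_all add: hcat_def)

lemma first_cols_index:
  assumes "i < dim_row A" "j < k" "j < dim_col A"
  shows "first_cols k A $$ (i, j) = A $$ (i, j)"
  using assms by (simp add: first_cols_def mat_of_cols_index)

lemma drop_cols_index:
  assumes "i < dim_row A" "k + j < dim_col A"
  shows "drop_cols k A $$ (i, j) = A $$ (i, k + j)"
  using assms by (simp add: drop_cols_def mat_of_cols_index)

lemma hcat_index:
  assumes "i < dim_row A" "j < dim_col A + dim_col B" "dim_row B = dim_row A"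
  shows "hcat A B $$ (i, j) = (if j < dim_col A then A $$ (i, j) else B $$ (i, j - dim_col A))"
  using assms by (auto simp: hcat_def mat_of_cols_index nth_append)

text \<open>
  With this matrix \<open>Q\<close> the truncation reads \<open>V' = Vh Q\<close> and \<open>X' S' = Xh Sh Q\<close>, so that it replaces
  \<open>Sh\<close> by \<open>Sh Q Q\<^sup>T\<close>.
\<close>

definition trunc_embed :: "nat \<Rightarrow> real mat \<Rightarrow> real mat" where
  "trunc_embed s W = mat (Suc (dim_row W)) (Suc s)
     (\<lambda>(i, j). if i = 0 then (if j = 0 then 1 else 0) else if j = 0 then 0 else W $$ (i - 1, j - 1))"

lemma dim_trunc_embed [simp]:
  "dim_row (trunc_embed s W) = Suc (dim_row W)" "dim_col (trunc_embed s W) = Suc s"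
  by (simp_all add: trunc_embed_def)

lemma trunc_embed_first:
  "j < Suc s \<Longrightarrow> trunc_embed s W $$ (0, j) = (if j = 0 then 1 else 0)"
  "i < Suc (dim_row W) \<Longrightarrow> trunc_embed s W $$ (i, 0) = (if i = 0 then 1 else 0)"
  by (simp_all add: trunc_embed_def)

lemma trunc_embed_Suc:
  "i < dim_row W \<Longrightarrow> j < s \<Longrightarrow> trunc_embed s W $$ (Suc i, Suc j) = W $$ (i, j)"
  by (simp add: trunc_embed_def)

lemma orthonormal_cols_index:
  assumes "orthonormal_cols Q" "i < dim_col Q" "j < dim_col Q"
  shows "(\<Sum>k<dim_row Q. Q $$ (k, i) * Q $$ (k, j)) = (if i = j then 1 else 0)"
proof -
  have "(\<Sum>k<dim_row Q. Q $$ (k, i) * Q $$ (k, j)) = (transpose_mat Q * Q) $$ (i, j)"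
    using assms by (simp add: scalar_prod_def atLeast0LessThan)
  also have "\<dots> = 1\<^sub>m (dim_col Q) $$ (i, j)"
    using assms(1) by (simp only: orthonormal_cols_def)
  finally show ?thesis
    using assms by simp
qed

lemma orthonormal_colsI:
  assumes "\<And>i j. i < dim_col Q \<Longrightarrow> j < dim_col Q \<Longrightarrow>
    (\<Sum>k<dim_row Q. Q $$ (k, i) * Q $$ (k, j)) = (if i = j then 1 else 0)"
  shows "orthonormal_cols Q"
  unfolding orthonormal_cols_def
  by (rule eq_matI) (use assms in \<open>auto simp: scalar_prod_def atLeast0LessThan\<close>)

lemma orthonormal_trunc_embed:
  assumes "orthonormal_cols W" "s \<le> dim_col W"
  shows "orthonormal_cols (trunc_embed s W)"
proof (rule orthonormal_colsI)
  fix i j assume "i < dim_col (trunc_embed s W)" "j < dim_col (trunc_embed s W)"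
  then show "(\<Sum>k<dim_row (trunc_embed s W). trunc_embed s W $$ (k, i) * trunc_embed s W $$ (k, j))
      = (if i = j then 1 else 0)"
    using assms orthonormal_cols_index[OF assms(1)]
    by (cases i; cases j)
       (simp_all add: sum.lessThan_Suc_shift trunc_embed_first trunc_embed_Suc del: sum.lessThan_Suc)
qed

lemma hcat_eq_mult_trunc_embed:
  assumes "dim_col A = Suc (dim_row W)" "s \<le> dim_col W"
  shows "hcat (first_cols 1 A) (drop_cols 1 A * first_cols s W) = A * trunc_embed s W"
proof (rule eq_matI)
  fix i j assume "i < dim_row (A * trunc_embed s W)" "j < dim_col (A * trunc_embed s W)"
  then have ij: "i < dim_row A" "j < Suc s" by auto
  show "hcat (first_cols 1 A) (drop_cols 1 A * first_cols s W) $$ (i, j) = (A * trunc_embed s W) $$ (i, j)"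
  proof (cases j)
    case 0
    then show ?thesis
      using ij assms
      by (simp add: hcat_index first_cols_index scalar_prod_def atLeast0LessThan trunc_embed_first
          sum.lessThan_Suc_shift del: sum.lessThan_Suc)
  next
    case (Suc l)
    then show ?thesis
      using ij assms
      by (simp add: hcat_index first_cols_index drop_cols_index scalar_prod_def atLeast0LessThan
          trunc_embed_first trunc_embed_Suc sum.lessThan_Suc_shift del: sum.lessThan_Suc)
  qed
qed (use assms in auto)

lemma first_cols_mult:
  assumes "dim_col A = dim_row B"
  shows "first_cols k (A * B) = A * first_cols k B"
  by (rule eq_matI)
     (use assms in \<open>auto simp: first_cols_index scalar_prod_def intro!: sum.cong\<close>)

lemma first_cols_diag:
  assumes "s \<le> n" "dim_col U = n"
  shows "first_cols s (U * mat_diag n f) = first_cols s U * mat_diag s f"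
  by (rule eq_matI)
     (use assms in \<open>auto simp: first_cols_index scalar_prod_def mat_diag_def if_distrib
        cong: if_cong\<close>)

lemma hcat_mult_block_diag:
  fixes P :: "real mat"
  assumes "dim_col P = 1" "dim_row R = dim_row P" "A \<in> carrier_mat 1 1" "dim_col R = s"
  shows "hcat P R * four_block_mat A (0\<^sub>m 1 s) (0\<^sub>m s 1) (mat_diag s f)
       = hcat (P * A) (R * mat_diag s f)"
proof (rule eq_matI)
  fix i j
  assume "i < dim_row (hcat (P * A) (R * mat_diag s f))" "j < dim_col (hcat (P * A) (R * mat_diag s f))"
  then have ij: "i < dim_row P" "j < Suc s" using assms by (auto simp: mat_diag_def)
  have A: "dim_row A = Suc 0" "dim_col A = Suc 0" using assms by auto
  show "(hcat P R * four_block_mat A (0\<^sub>m 1 s) (0\<^sub>m s 1) (mat_diag s f)) $$ (i, j)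
      = hcat (P * A) (R * mat_diag s f) $$ (i, j)"
    using assms ij A
    by (cases j) (simp_all add: hcat_index scalar_prod_def atLeast0LessThan sum.lessThan_Suc_shift mat_diag_def
        del: sum.lessThan_Suc)
qed (use assms in \<open>auto simp: mat_diag_def\<close>)

text \<open>The SVD gives \<open>Srem * W = U * mat_diag n sv\<close>, so keeping the first
  \<open>s\<close> singular triples is the same as multiplying \<open>Srem\<close> from the right by
  the first \<open>s\<close> columns of \<open>W\<close>. The QR factorizations cancel in the
  product \<open>X' * S'\<close>.\<close>

lemma truncation_embedding:
  assumes trunc: "truncation \<theta> Xh Sh Vh X' S' V'"
    and dims: "dim_col Xh = dim_row Sh" "dim_col Sh = Suc n" "dim_col Vh = Suc n"
  obtains s W where "W \<in> carrier_mat n n" "orthonormal_cols W" "s \<le> n"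
    "V' = Vh * trunc_embed s W" "X' * S' = Xh * Sh * trunc_embed s W"
proof -
  define K where "K = Xh * Sh"
  have dK [simp]: "dim_col K = Suc n" "dim_row K = dim_row Xh" using dims by (simp_all add: K_def)
  obtain Xap Sap Xrem Srem U sv W s R2 where
    qr1: "is_QR (drop_cols 1 K) Xrem Srem" and qr2: "is_QR (first_cols 1 K) Xap Sap"
    and svd: "is_SVD Srem U sv W" and s: "s \<le> dim_row Srem"
    and qr3: "is_QR (hcat Xap (Xrem * first_cols s U)) X' R2"
    and S': "S' = R2 * four_block_mat Sap (0\<^sub>m 1 s) (0\<^sub>m s 1) (mat_diag s sv)"
    and V': "V' = hcat (first_cols 1 Vh) (drop_cols 1 Vh * first_cols s W)"
    using trunc unfolding truncation_def K_def[symmetric] by blast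
  have Xrem [simp]: "dim_row Xrem = dim_row Xh" "dim_col Xrem = n" "dim_row Srem = n" "dim_col Srem = n"
    and Krem: "drop_cols 1 K = Xrem * Srem"
    using qr1 by (auto simp: is_QR_def)
  have Xap: "dim_row Xap = dim_row Xh" "dim_col Xap = 1" "Sap \<in> carrier_mat 1 1"
    and Kap: "first_cols 1 K = Xap * Sap"
    using qr2 by (auto simp: is_QR_def)
  have W: "W \<in> carrier_mat n n" "orthonormal_cols W"
    and [simp]: "dim_row U = n" "dim_col U = n" "dim_row W = n" "dim_col W = n"
    and Srem: "Srem = U * mat_diag n sv * transpose_mat W"
    using svd by (auto simp: is_SVD_def Let_def)
  have sn: "s \<le> n" using s by simp
  have X': "dim_col X' = Suc s" "dim_row R2 = Suc s" "dim_col R2 = Suc s"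
    and R2: "hcat Xap (Xrem * first_cols s U) = X' * R2"
    using qr3 Xap sn by (auto simp: is_QR_def min_def)
  have trem: "Xrem * first_cols s U * mat_diag s sv = drop_cols 1 K * first_cols s W"
  proof -
    have "Srem * W = U * mat_diag n sv * (transpose_mat W * W)"
      unfolding Srem by (simp add: mat_assoc)
    also have "\<dots> = U * mat_diag n sv"
      using W(2) by (simp add: orthonormal_cols_def right_mult_one_mat')
    finally have "first_cols s (Srem * W) = first_cols s U * mat_diag s sv"
      using sn by (simp add: first_cols_diag)
    then have "Srem * first_cols s W = first_cols s U * mat_diag s sv"
      by (simp add: first_cols_mult)
    then show ?thesis
      using sn unfolding Krem by (simp add: mat_assoc min_def)
  qed
  have "X' * S' = hcat Xap (Xrem * first_cols s U)
      * four_block_mat Sap (0\<^sub>m 1 s) (0\<^sub>m s 1) (mat_diag s sv)"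
    unfolding S' R2 using X' Xap by (subst mat_assoc) auto
  also have "\<dots> = hcat (Xap * Sap) (Xrem * first_cols s U * mat_diag s sv)"
    using Xap sn by (intro hcat_mult_block_diag) auto
  also have "\<dots> = K * trunc_embed s W"
    unfolding trem Kap[symmetric] using sn by (intro hcat_eq_mult_trunc_embed) auto
  finally have "X' * S' = Xh * Sh * trunc_embed s W"
    by (simp add: K_def)
  moreover have "V' = Vh * trunc_embed s W"
    unfolding V' using sn dims by (intro hcat_eq_mult_trunc_embed) auto
  ultimately show ?thesis
    using that W sn by blast
qed

lemma truncation_effect:
  assumes trunc: "truncation \<theta> Xh Sh Vh X' S' V'"
    and Xh: "Xh \<in> carrier_mat m (Suc n)" and Sh: "Sh \<in> carrier_mat (Suc n) (Suc n)"
    and Vh: "Vh \<in> carrier_mat N (Suc n)" "orthonormal_cols Vh" "col Vh 0 = unit_vec N 0"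
    and N: "0 < N"
  defines "gh \<equiv> Xh * Sh * transpose_mat Vh" and "g' \<equiv> X' * S' * transpose_mat V'"
  shows "g' \<in> carrier_mat m N" "frob g' g' \<le> frob gh gh"
    "\<And>i. i < m \<Longrightarrow> g' $$ (i, 0) = gh $$ (i, 0)"
proof -
  note dims [simp] = carrier_matD[OF Xh] carrier_matD[OF Sh] carrier_matD[OF Vh(1)]
  obtain s W where W: "W \<in> carrier_mat n n" "orthonormal_cols W" "s \<le> n"
    and V': "V' = Vh * trunc_embed s W" and K': "X' * S' = Xh * Sh * trunc_embed s W"
    by (rule truncation_embedding[OF trunc, of n]) auto
  define K where "K = Xh * Sh"
  define Q where "Q = trunc_embed s W"
  have [simp]: "dim_row Q = Suc n" "dim_col Q = Suc s" "dim_row K = m" "dim_col K = Suc n"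
    using W by (auto simp: Q_def K_def)
  have Q: "orthonormal_cols Q"
    unfolding Q_def using W by (intro orthonormal_trunc_embed) auto
  have g': "g' = K * Q * transpose_mat Q * transpose_mat Vh"
    by (simp add: g'_def V' K' K_def[symmetric] Q_def[symmetric] transpose_mult_dim mat_assoc)
  show "g' \<in> carrier_mat m N"
    by (rule carrier_matI) (simp_all add: g')
  have "frob g' g' = frob (K * Q * transpose_mat Q) (K * Q * transpose_mat Q)"
    unfolding g' using Vh(2) by (subst frob_isometry_right) auto
  also have "\<dots> \<le> frob K K"
    by (rule frob_projection_le[OF Q]) simp
  also have "frob K K = frob gh gh"
    unfolding gh_def K_def[symmetric] using Vh(2) by (subst frob_isometry_right) auto
  finally show "frob g' g' \<le> frob gh gh" .
  have V0: "Vh $$ (k, 0) = (if k = 0 then 1 else 0)" if "k < N" for k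
    using arg_cong[OF Vh(3), of "\<lambda>v. v $ k"] that by auto
  \<comment> \<open>Column 0 is the first unit vector and the other columns are orthogonal to it, so
    their first entries vanish. Hence the first moment depends on the first coefficient column
    alone, which the truncation does not touch.\<close>
  have Vrow: "Vh $$ (0, l) = (if l = 0 then 1 else 0)" if "l < Suc n" for l
  proof -
    have "(\<Sum>k<N. Vh $$ (k, 0) * Vh $$ (k, l)) = (\<Sum>k<N. if k = 0 then Vh $$ (k, l) else 0)"
      by (intro sum.cong refl) (simp add: V0)
    also have "\<dots> = Vh $$ (0, l)" using N by simp
    finally show ?thesis
      using orthonormal_cols_index[OF Vh(2), of 0 l] that by auto
  qed
  have col0: "(B * transpose_mat Vh) $$ (i, 0) = B $$ (i, 0)"
    if "dim_col B = Suc n" "i < dim_row B" for B i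
    using that N
    by (simp add: scalar_prod_def atLeast0LessThan Vrow sum.lessThan_Suc_shift del: sum.lessThan_Suc)
  fix i assume i: "i < m"
  have "g' $$ (i, 0) = (K * Q * transpose_mat Q) $$ (i, 0)"
    unfolding g' using i by (intro col0) auto
  also have "\<dots> = (K * Q) $$ (i, 0)"
    using i by (subst index_mult_mat) (simp_all add: scalar_prod_def atLeast0LessThan Q_def trunc_embed_first
        sum.lessThan_Suc_shift del: sum.lessThan_Suc index_mult_mat(1))
  also have "\<dots> = K $$ (i, 0)"
    using i W by (simp add: scalar_prod_def atLeast0LessThan Q_def trunc_embed_first
        sum.lessThan_Suc_shift del: sum.lessThan_Suc)
  also have "\<dots> = gh $$ (i, 0)"
    unfolding gh_def K_def[symmetric] using i by (intro col0[symmetric]) auto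
  finally show "g' $$ (i, 0) = gh $$ (i, 0)" .
qed

section \<open>Dissipation of the moments\<close>

text \<open>The largest weight is at least the average weight
  \<open>2 / real (Nang p + 1)\<close>.\<close>

lemma beta_ge_2:
  assumes "gauss_legendre (Nang p + 1) (mu p) (wt p)"
  shows "2 \<le> beta p"
proof -
  have "wt p k * real (Nang p + 1) \<le> beta p" if "k < Nang p + 1" for k
    unfolding beta_def using that by (intro Max_ge) auto
  then have "(\<Sum>k<Nang p + 1. wt p k * real (Nang p + 1)) \<le> real (card {..<Nang p + 1}) * beta p"
    by (intro sum_bounded_above) simp
  moreover have "(\<Sum>k<Nang p + 1. wt p k * real (Nang p + 1)) = real (Nang p + 1) * 2"
  proof -
    have "(\<Sum>k<Nang p + 1. wt p k) = 2"
      by (rule gauss_legendre_weight_sum[OF assms]) simp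
    then show ?thesis
      by (simp only: sum_distrib_right[symmetric] mult.commute)
  qed
  ultimately have "real (Nang p + 1) * 2 \<le> real (Nang p + 1) * beta p"
    by (simp only: card_lessThan)
  then show ?thesis
    by (rule mult_left_le_imp_le) simp
qed

section \<open>Fluxes in nodal values\<close>

lemma dim_T_mat [simp]: "dim_row (T_mat p) = Nang p" "dim_col (T_mat p) = Nang p + 1"
  by (simp_all add: T_mat_def)

lemma half_double_mat: "(1 / 2) \<cdot>\<^sub>m (2 \<cdot>\<^sub>m A) = (A :: real mat)"
  by (rule eq_matI) auto

lemma smult_mult_mat:
  fixes A B :: "real mat"
  assumes "dim_col A = dim_row B"
  shows "A * (c \<cdot>\<^sub>m B) = c \<cdot>\<^sub>m (A * B)" "(c \<cdot>\<^sub>m A) * B = c \<cdot>\<^sub>m (A * B)"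
proof -
  have A: "A \<in> carrier_mat (dim_row A) (dim_col A)" and B: "B \<in> carrier_mat (dim_col A) (dim_col B)"
    using assms by (auto intro: carrier_matI)
  show "A * (c \<cdot>\<^sub>m B) = c \<cdot>\<^sub>m (A * B)"
    by (rule mult_smult_distrib[OF A B])
  show "(c \<cdot>\<^sub>m A) * B = c \<cdot>\<^sub>m (A * B)"
    by (rule mult_smult_assoc_mat[OF A B])
qed

lemma A_plus_factor:
  "A_plus p = T_mat p * mat_diag (Nang p + 1) (\<lambda>k. max (mu p k) 0) * transpose_mat (T_mat p)"
proof -
  have "M_mat p + M_abs p = 2 \<cdot>\<^sub>m mat_diag (Nang p + 1) (\<lambda>k. max (mu p k) 0)"
    by (rule eq_matI) (simp_all add: M_mat_def M_abs_def mat_diag_def max_def min_def)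
  then show ?thesis
    unfolding A_plus_def
    by (simp only: smult_mult_mat half_double_mat dim_mat_diag dim_T_mat index_mult_mat index_smult_mat index_transpose_mat)
qed

lemma A_minus_factor:
  "A_minus p = T_mat p * mat_diag (Nang p + 1) (\<lambda>k. min (mu p k) 0) * transpose_mat (T_mat p)"
proof -
  have "M_mat p - M_abs p = 2 \<cdot>\<^sub>m mat_diag (Nang p + 1) (\<lambda>k. min (mu p k) 0)"
    by (rule eq_matI) (simp_all add: M_mat_def M_abs_def mat_diag_def max_def min_def)
  then show ?thesis
    unfolding A_minus_def
    by (simp only: smult_mult_mat half_double_mat dim_mat_diag dim_T_mat index_mult_mat index_smult_mat index_transpose_mat)
qed

lemma frob_mult_diag:
  assumes "dim_col B = n"
  shows "frob (B * mat_diag n f) C = (\<Sum>k<n. f k * (\<Sum>j<dim_row B. B $$ (j, k) * C $$ (j, k)))"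
proof -
  have "frob (B * mat_diag n f) C = (\<Sum>j<dim_row B. \<Sum>k<n. B $$ (j, k) * f k * C $$ (j, k))"
    using assms by (simp add: frob_def mat_diag_mult_right[OF carrier_matI[OF refl assms]])
  also have "\<dots> = (\<Sum>k<n. f k * (\<Sum>j<dim_row B. B $$ (j, k) * C $$ (j, k)))"
    by (subst sum.swap) (simp add: sum_distrib_left mult_ac)
  finally show ?thesis .
qed

lemma frob_Dminus_diag:
  assumes "z \<in> carrier_mat (nJ p) n" "x \<in> carrier_mat (nJ p) n" "0 < Nx p"
  shows "frob (Dminus p z * mat_diag n f) x =
    (\<Sum>k<n. f k * (\<Sum>i<Nx p. jump (bc p) (col z k) i * iface_val (bc p) (col x k) (int i))) / dx p"
proof -
  have "(\<Sum>j<nJ p. Dminus p z $$ (j, k) * x $$ (j, k))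
      = (\<Sum>i<Nx p. jump (bc p) (col z k) i * iface_val (bc p) (col x k) (int i)) / dx p"
    if "k < n" for k
    using assms that sum_backward_diff[of "col x k" "bc p" "Nx p" "col z k"]
    by (simp add: Dminus_def sum_divide_distrib[symmetric])
  then show ?thesis
    using assms unfolding sum_divide_distrib[of _ "{..<n}"] by (simp add: frob_mult_diag)
qed

lemma frob_Dplus_diag:
  assumes "z \<in> carrier_mat (nJ p) n" "x \<in> carrier_mat (nJ p) n" "0 < Nx p"
  shows "frob (Dplus p z * mat_diag n f) x =
    (\<Sum>k<n. f k * (\<Sum>i<Nx p. jump (bc p) (col z k) i * iface_val (bc p) (col x k) (int i - 1))) / dx p"
proof -
  have "(\<Sum>j<nJ p. Dplus p z $$ (j, k) * x $$ (j, k))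
      = (\<Sum>i<Nx p. jump (bc p) (col z k) i * iface_val (bc p) (col x k) (int i - 1)) / dx p"
    if "k < n" for k
    using assms that sum_forward_diff[of "col x k" "bc p" "Nx p" "col z k"]
    by (simp add: Dplus_def sum_divide_distrib[symmetric])
  then show ?thesis
    using assms unfolding sum_divide_distrib[of _ "{..<n}"] by (simp add: frob_mult_diag)
qed

text \<open>\<open>A_plus\<close> and \<open>A_minus\<close> are diagonal matrices between
  \<open>T_mat p\<close> and its transpose. One factor combines with \<open>g\<close>, the other
  moves to \<open>gh\<close> by adjointness, and what remains is a scalar upwind flux for each
  node.\<close>

lemma frob_flux:
  assumes g: "g \<in> carrier_mat (nJ p) (Nang p)" and gh: "gh \<in> carrier_mat (nJ p) (Nang p)"
    and n: "0 < Nx p"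
  defines "z \<equiv> g * T_mat p" and "x \<equiv> gh * T_mat p"
  shows "frob (Dminus p g * A_plus p) gh + frob (Dplus p g * A_minus p) gh =
    (\<Sum>k<Nang p + 1.
        max (mu p k) 0 * (\<Sum>i<Nx p. jump (bc p) (col z k) i * iface_val (bc p) (col x k) (int i))
      + min (mu p k) 0 * (\<Sum>i<Nx p. jump (bc p) (col z k) i * iface_val (bc p) (col x k) (int i - 1)))
    / dx p"
proof -
  note [simp] = carrier_matD[OF g] carrier_matD[OF gh]
  have z: "z \<in> carrier_mat (nJ p) (Nang p + 1)" and x: "x \<in> carrier_mat (nJ p) (Nang p + 1)"
    by (auto simp: z_def x_def)
  have "frob (H * (T_mat p * E * transpose_mat (T_mat p))) gh = frob (H * T_mat p * E) x"
    if "dim_row H = nJ p" "dim_col H = Nang p" "dim_row E = Nang p + 1" "dim_col E = Nang p + 1" for H E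
  proof -
    have "H * (T_mat p * E * transpose_mat (T_mat p)) = (H * T_mat p * E) * transpose_mat (T_mat p)"
      using that by (simp add: mat_assoc)
    then show ?thesis
      using that by (simp add: frob_mult_right x_def)
  qed
  then have "frob (Dminus p g * A_plus p) gh
      = frob (Dminus p z * mat_diag (Nang p + 1) (\<lambda>k. max (mu p k) 0)) x"
    and "frob (Dplus p g * A_minus p) gh
      = frob (Dplus p z * mat_diag (Nang p + 1) (\<lambda>k. min (mu p k) 0)) x"
    by (simp_all add: A_plus_factor A_minus_factor z_def Dminus_mult Dplus_mult)
  then show ?thesis
    by (simp only: frob_Dminus_diag[OF z x n] frob_Dplus_diag[OF z x n] add_divide_distrib sum.distrib)
qed

lemma frob_cols: "frob A A = (\<Sum>k<dim_col A. \<Sum>j<dim_row A. (col A k $ j)\<^sup>2)"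
  unfolding frob_def by (subst sum.swap) (simp add: power2_eq_square)

lemma frob_polarization:
  assumes "dim_row A = dim_row B" "dim_col A = dim_col B"
  shows "2 * frob (A - B) A = frob A A - frob B B + frob (A - B) (A - B)"
  using assms
  by (simp add: frob_minus_left frob_commute[of A "A - B"] frob_commute[of B "A - B"] frob_commute[of A B])

lemma col_minus:
  assumes "dim_row A = dim_row B" "dim_col A = dim_col B" "k < dim_col B"
  shows "col (A - B) k = col A k - col B k"
  using assms by (intro eq_vecI) auto

text \<open>Recovering the first moment from the nodal values turns it into a quadrature of \<open>\<mu>\<close>, as
  \<open>P\<^sub>1\<close> is proportional to \<open>\<mu>\<close>; this is why the dissipation, weighted with \<open>\<mu>\<^sup>2\<close>, controls it.\<close>

lemma sum_jump_first_moment_le: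
  assumes gl: "gauss_legendre (Nang p + 1) (mu p) (wt p)" and N: "0 < Nang p"
    and G: "G \<in> carrier_mat (nJ p) (Nang p)" and J: "0 < nJ p"
  shows "(\<Sum>i<Nx p. (jump (bc p) (col G 0) i)\<^sup>2)
    \<le> 3 * (\<Sum>k<Nang p + 1. (mu p k)\<^sup>2 * (\<Sum>i<Nx p. (jump (bc p) (col (G * T_mat p) k) i)\<^sup>2))"
proof -
  let ?x = "G * T_mat p" and ?K = "Nang p + 1"
  note [simp] = carrier_matD[OF G]
  have "G = ?x * transpose_mat (T_mat p)"
    by (simp add: mat_assoc T_mat_orthonormal[OF gl] right_mult_one_mat')
  then have "iface_val (bc p) (col G 0) j = iface_val (bc p) (col (?x * transpose_mat (T_mat p)) 0) j" for j
    by simp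
  also have "\<dots> j = (\<Sum>k<?K. iface_val (bc p) (col ?x k) j * T_mat p $$ (0, k))" for j
    using N J by (subst iface_val_col_mult) (auto intro!: sum.cong)
  finally have jump: "jump (bc p) (col G 0) i = (\<Sum>k<?K. jump (bc p) (col ?x k) i * T_mat p $$ (0, k))" for i
    by (simp only: jump_def sum_subtractf[symmetric] left_diff_distrib)
  have T0: "T_mat p $$ (0, k) = sqrt (wt p k) * (sqrt (3 / 2) * mu p k)" if "k < ?K" for k
    using N that legendre_normalized_1 by (simp add: T_mat_def)
  \<comment> \<open>This 2, times the 3 / 2 from the square of the normalized first Legendre
    polynomial, is the constant 3 of the claim.\<close>
  have W: "(\<Sum>k<?K. (sqrt (wt p k))\<^sup>2) = 2"
    using gauss_legendre_weight_pos[OF gl] gauss_legendre_weight_sum[OF gl]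
    by (simp add: less_imp_le)
  have "(jump (bc p) (col G 0) i)\<^sup>2 \<le> 3 * (\<Sum>k<?K. (mu p k)\<^sup>2 * (jump (bc p) (col ?x k) i)\<^sup>2)" for i
  proof -
    have "(jump (bc p) (col G 0) i)\<^sup>2
        = (\<Sum>k<?K. sqrt (wt p k) * (sqrt (3 / 2) * mu p k * jump (bc p) (col ?x k) i))\<^sup>2"
      unfolding jump by (intro arg_cong[of _ _ "\<lambda>x. x\<^sup>2"] sum.cong refl) (simp add: T0 mult_ac)
    also have "\<dots> \<le> (\<Sum>k<?K. (sqrt (wt p k))\<^sup>2) * (\<Sum>k<?K. (sqrt (3 / 2) * mu p k * jump (bc p) (col ?x k) i)\<^sup>2)"
      by (rule Cauchy_Schwarz_ineq_sum)
    also have "\<dots> = 3 * (\<Sum>k<?K. (mu p k)\<^sup>2 * (jump (bc p) (col ?x k) i)\<^sup>2)"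
      unfolding W sum_distrib_left
      by (intro sum.cong refl) (simp add: power_mult_distrib)
    finally show ?thesis .
  qed
  then have "(\<Sum>i<Nx p. (jump (bc p) (col G 0) i)\<^sup>2)
      \<le> (\<Sum>i<Nx p. 3 * (\<Sum>k<?K. (mu p k)\<^sup>2 * (jump (bc p) (col ?x k) i)\<^sup>2))"
    by (intro sum_mono)
  also have "\<dots> = 3 * (\<Sum>k<?K. (mu p k)\<^sup>2 * (\<Sum>i<Nx p. (jump (bc p) (col ?x k) i)\<^sup>2))"
    unfolding sum_distrib_left[symmetric] by (subst sum.swap) (simp only: sum_distrib_left)
  finally show ?thesis .
qed

text \<open>Measured in units of \<open>c * \<tau> * (m\<^sup>2 / (4 * d\<^sup>2))\<close>, the CFL
  condition provides \<open>5 * \<beta>\<close>, hence at least 10. The Young term, whose weight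
  \<open>\<epsilon> * d / (2 * c * \<tau>)\<close> appears in the denominator, costs 2, and the
  right-hand side is the remaining 8.\<close>

lemma cfl_coefficient:
  fixes \<epsilon> c d \<tau> \<sigma> \<beta> m :: real
  assumes pos: "0 < \<epsilon>" "0 < c" "0 < d" "0 < \<tau>" "0 < \<sigma>" "2 \<le> \<beta>"
    and cfl: "m \<noteq> 0 \<Longrightarrow> \<tau> \<le> 1 / (5 * c * \<beta>) * (2 * \<epsilon> * d / \<bar>m\<bar> + \<sigma> * d\<^sup>2 / m\<^sup>2)"
  shows "\<epsilon> / d * (m\<^sup>2 / (4 * (\<epsilon> * d / (2 * c * \<tau>))) - \<bar>m\<bar> / 2) - \<sigma> / 4 \<le> - (2 * c * \<tau> / d\<^sup>2) * m\<^sup>2"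
proof (cases "m = 0")
  case True
  then show ?thesis using pos by simp
next
  case False
  have "5 * c * \<beta> * \<tau> \<le> 2 * \<epsilon> * d / \<bar>m\<bar> + \<sigma> * d\<^sup>2 / m\<^sup>2"
    using cfl[OF False] pos by (simp add: field_simps)
  \<comment> \<open>This factor turns the two summands of the CFL bound into the upwind dissipation
    and the absorption per squared jump.\<close>
  then have "(5 * c * \<beta> * \<tau>) * (m\<^sup>2 / (4 * d\<^sup>2)) \<le> (2 * \<epsilon> * d / \<bar>m\<bar> + \<sigma> * d\<^sup>2 / m\<^sup>2) * (m\<^sup>2 / (4 * d\<^sup>2))"
    by (rule mult_right_mono) simp
  also have "\<dots> = \<epsilon> / d * (\<bar>m\<bar> / 2) + \<sigma> / 4"
  proof -
    have "(2 * \<epsilon> * d / x + \<sigma> * d\<^sup>2 / x\<^sup>2) * (x\<^sup>2 / (4 * d\<^sup>2)) = \<epsilon> / d * (x / 2) + \<sigma> / 4"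
      if "0 < x" for x
      using pos that by (simp add: field_simps power2_eq_square)
    from this[of "\<bar>m\<bar>"] show ?thesis
      using False by simp
  qed
  finally have 1: "(5 * c * \<beta> * \<tau>) * (m\<^sup>2 / (4 * d\<^sup>2)) \<le> \<epsilon> / d * (\<bar>m\<bar> / 2) + \<sigma> / 4" .
  have "10 * (c * \<tau> * (m\<^sup>2 / (4 * d\<^sup>2))) \<le> 5 * \<beta> * (c * \<tau> * (m\<^sup>2 / (4 * d\<^sup>2)))"
    using pos by (intro mult_right_mono) auto
  with 1 have "10 * (c * \<tau> * (m\<^sup>2 / (4 * d\<^sup>2))) \<le> \<epsilon> / d * (\<bar>m\<bar> / 2) + \<sigma> / 4"
    by (simp only: mult_ac)
  moreover have "\<epsilon> / d * (m\<^sup>2 / (4 * (\<epsilon> * d / (2 * c * \<tau>)))) = 2 * (c * \<tau> * (m\<^sup>2 / (4 * d\<^sup>2)))"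
    using pos by (simp add: field_simps power2_eq_square)
  moreover have "(2 * c * \<tau> / d\<^sup>2) * m\<^sup>2 = 8 * (c * \<tau> * (m\<^sup>2 / (4 * d\<^sup>2)))"
    by (simp add: field_simps)
  ultimately show ?thesis
    unfolding right_diff_distrib mult_minus_left by linarith
qed

text \<open>In the periodic case the last interface is the right end of the domain, which the closed
  interval in \<open>admissible\<close> includes.\<close>

lemma sigma_iface_ge:
  assumes "admissible p" "j < nJ p"
  shows "sigma0 p \<le> sigma_iface p j"
proof -
  have "j + 1 \<le> Nx p" using assms(2) by (cases "bc p") (auto simp: num_ifaces_def)
  then have "(real j + 1) * dx p \<le> real (Nx p) * dx p"
    using assms(1) by (intro mult_right_mono) (auto simp: admissible_def)
  then show ?thesis
    using assms(1) by (auto simp: admissible_def sigma_iface_def)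
qed

lemma sigma_mid_ge:
  assumes "admissible p" "i < Nx p"
  shows "sigma0 p \<le> sigma_mid p i"
proof -
  have "(real i + 1 / 2) * dx p \<le> real (Nx p) * dx p"
    using assms by (intro mult_right_mono) (auto simp: admissible_def)
  then show ?thesis
    using assms(1) by (auto simp: admissible_def sigma_mid_def)
qed

lemma frob_absorption_ge:
  assumes "admissible p" "gh \<in> carrier_mat (nJ p) n"
  shows "sigma0 p * frob gh gh \<le> frob (mat_diag (nJ p) (sigma_iface p) * gh) gh"
proof -
  have "frob (mat_diag (nJ p) (sigma_iface p) * gh) gh
      = (\<Sum>j<nJ p. \<Sum>k<n. sigma_iface p j * (gh $$ (j, k))\<^sup>2)"
    using assms(2) by (simp add: frob_def mat_diag_mult_left[OF assms(2)] power2_eq_square mult_ac)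
  moreover have "sigma0 p * frob gh gh = (\<Sum>j<nJ p. \<Sum>k<n. sigma0 p * (gh $$ (j, k))\<^sup>2)"
    using assms(2) by (simp add: frob_def sum_distrib_left power2_eq_square)
  ultimately show ?thesis
    using sigma_iface_ge[OF assms(1)] by (auto intro!: sum_mono mult_right_mono)
qed

lemma frob_outer_prod_b:
  assumes "gh \<in> carrier_mat (dim_vec s) (Nang p)" "0 < Nang p"
  shows "frob (outer_prod s (b_vec p)) gh = \<gamma>1 * (\<Sum>j<dim_vec s. s $ j * gh $$ (j, 0))"
proof -
  have "frob (outer_prod s (b_vec p)) gh
      = (\<Sum>j<dim_vec s. \<Sum>k<Nang p. if k = 0 then \<gamma>1 * (s $ j * gh $$ (j, k)) else 0)"
    unfolding frob_def dim_outer_prod dim_b_vec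
    by (intro sum.cong refl) (auto simp: outer_prod_def b_vec_def)
  also have "\<dots> = \<gamma>1 * (\<Sum>j<dim_vec s. s $ j * gh $$ (j, 0))"
    using assms(2) by (simp add: sum_distrib_left)
  finally show ?thesis .
qed

text \<open>The gain from polarizing the time difference is spent in the flux estimate, and
  absorption is converted from squares to squared jumps, so that the CFL condition can be applied
  node by node. The source term stays exact, for cancellation against the macroscopic
  update.\<close>

lemma moment_dissipation:
  assumes adm: "admissible p" and J: "0 < nJ p"
    and g: "g \<in> carrier_mat (nJ p) (Nang p)" and gh: "gh \<in> carrier_mat (nJ p) (Nang p)"
    and CFL: "\<forall>k\<le>Nang p. mu p k \<noteq> 0 \<longrightarrow>
      dt p \<le> 1 / (5 * light p * beta p) *
        (2 * eps p * dx p / \<bar>mu p k\<bar> + sigma0 p * (dx p)\<^sup>2 / (mu p k)\<^sup>2)"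
    and tested: "(eps p)\<^sup>2 / light p / dt p * frob (gh - g) gh =
      - eps p * (frob (Dminus p g * A_plus p) gh + frob (Dplus p g * A_minus p) gh)
      - frob (outer_prod (s_vec p h T) (b_vec p)) gh
      - frob (mat_diag (nJ p) (sigma_iface p) * gh) gh"
  shows "(eps p)\<^sup>2 / light p / dt p / 2 * (frob gh gh - frob g g)
    \<le> - \<gamma>1 * (\<Sum>j<nJ p. s_vec p h T $ j * gh $$ (j, 0))
       - 2 / 3 * (light p * dt p / (dx p)\<^sup>2) * (\<Sum>i<Nx p. (jump (bc p) (col gh 0) i)\<^sup>2)"
proof -
  have pos: "0 < eps p" "0 < light p" "0 < sigma0 p" "0 < Nang p" "0 < Nx p" "0 < dx p" "0 < dt p"
    and gl: "gauss_legendre (Nang p + 1) (mu p) (wt p)"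
    using adm by (auto simp: admissible_def)
  note [simp] = carrier_matD[OF g] carrier_matD[OF gh]
  note sum.lessThan_Suc [simp del]
  let ?K = "Nang p + 1"
  define z where "z = g * T_mat p"
  define x where "x = gh * T_mat p"
  have [simp]: "dim_row z = nJ p" "dim_col z = ?K" "dim_row x = nJ p" "dim_col x = ?K"
    by (simp_all add: z_def x_def)
  define Jk where "Jk k = (\<Sum>i<Nx p. (jump (bc p) (col x k) i)\<^sup>2)" for k
  define Ek where "Ek k = (\<Sum>j<nJ p. ((col x k - col z k) $ j)\<^sup>2)" for k
  \<comment> \<open>With this weight the Young term is exactly \<open>a / 2\<close> times the
    squared increment, the amount that polarization provides in \<open>pol\<close>.\<close>
  define l where "l = eps p * dx p / (2 * light p * dt p)"
  define a where "a = (eps p)\<^sup>2 / light p / dt p"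
  have l: "0 < l" using pos by (simp add: l_def)
  have la: "eps p / dx p * l = a / 2"
    using pos by (simp add: l_def a_def field_simps power2_eq_square)
  have ToN: "orthonormal_cols (transpose_mat (T_mat p))"
    by (simp add: orthonormal_cols_def T_mat_orthonormal[OF gl])
  have gh_x: "frob gh gh = frob x x"
    using frob_isometry_right[OF ToN, of gh gh] by (simp add: x_def)
  have "x - z = (gh - g) * T_mat p"
    unfolding x_def z_def
    by (rule minus_mult_distrib_mat[symmetric, OF gh g, of _ ?K]) (rule carrier_matI; simp)
  then have "frob (gh - g) (gh - g) = frob (x - z) (x - z)"
    using frob_isometry_right[OF ToN, of "gh - g" "gh - g"] by simp
  also have "\<dots> = (\<Sum>k<?K. Ek k)"
    unfolding frob_cols Ek_def by (intro sum.cong) (simp_all add: col_minus)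
  finally have E: "frob (gh - g) (gh - g) = (\<Sum>k<?K. Ek k)" .
  have jumps: "(\<Sum>k<?K. Jk k) \<le> 4 * frob gh gh"
  proof -
    have "(\<Sum>k<?K. Jk k) \<le> (\<Sum>k<?K. 4 * (\<Sum>j<nJ p. (col x k $ j)\<^sup>2))"
      unfolding Jk_def by (intro sum_mono sum_jump_square_le) (use pos in auto)
    then show ?thesis
      unfolding gh_x frob_cols[of x] sum_distrib_left[symmetric] by simp
  qed
  have absorb: "sigma0 p / 4 * (\<Sum>k<?K. Jk k) \<le> frob (mat_diag (nJ p) (sigma_iface p) * gh) gh"
  proof -
    have "sigma0 p / 4 * (\<Sum>k<?K. Jk k) \<le> sigma0 p / 4 * (4 * frob gh gh)"
      by (rule mult_left_mono[OF jumps]) (use pos in simp)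
    then show ?thesis
      using frob_absorption_ge[OF adm gh] by linarith
  qed
  have flux: "- eps p * (frob (Dminus p g * A_plus p) gh + frob (Dplus p g * A_minus p) gh)
      \<le> a / 2 * (\<Sum>k<?K. Ek k) + (\<Sum>k<?K. eps p / dx p * ((mu p k)\<^sup>2 / (4 * l) - \<bar>mu p k\<bar> / 2) * Jk k)"
  proof -
    let ?F = "\<lambda>k. max (mu p k) 0 * (\<Sum>i<Nx p. jump (bc p) (col z k) i * iface_val (bc p) (col x k) (int i))
      + min (mu p k) 0 * (\<Sum>i<Nx p. jump (bc p) (col z k) i * iface_val (bc p) (col x k) (int i - 1))"
    have "frob (Dminus p g * A_plus p) gh + frob (Dplus p g * A_minus p) gh = (\<Sum>k<?K. ?F k) / dx p"
      unfolding z_def x_def by (rule frob_flux[OF g gh pos(5)])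
    then have "- eps p * (frob (Dminus p g * A_plus p) gh + frob (Dplus p g * A_minus p) gh)
        = eps p / dx p * (\<Sum>k<?K. - ?F k)"
      by (simp only: sum_negf) simp
    also have "\<dots> \<le> eps p / dx p * (\<Sum>k<?K. l * Ek k + ((mu p k)\<^sup>2 / (4 * l) - \<bar>mu p k\<bar> / 2) * Jk k)"
      unfolding Ek_def Jk_def
      by (intro mult_left_mono sum_mono upwind_estimate) (use pos l in auto)
    also have "\<dots> = (eps p / dx p * l) * (\<Sum>k<?K. Ek k)
        + (\<Sum>k<?K. eps p / dx p * ((mu p k)\<^sup>2 / (4 * l) - \<bar>mu p k\<bar> / 2) * Jk k)"
      by (simp only: sum.distrib distrib_left sum_distrib_left mult.assoc)
    finally show ?thesis unfolding la .
  qed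
  have "(\<Sum>k<?K. (eps p / dx p * ((mu p k)\<^sup>2 / (4 * l) - \<bar>mu p k\<bar> / 2) - sigma0 p / 4) * Jk k)
      \<le> (\<Sum>k<?K. (- (2 * light p * dt p / (dx p)\<^sup>2) * (mu p k)\<^sup>2) * Jk k)"
  proof (intro sum_mono mult_right_mono)
    fix k assume "k \<in> {..<?K}"
    then show "eps p / dx p * ((mu p k)\<^sup>2 / (4 * l) - \<bar>mu p k\<bar> / 2) - sigma0 p / 4
        \<le> - (2 * light p * dt p / (dx p)\<^sup>2) * (mu p k)\<^sup>2"
      unfolding l_def using CFL pos beta_ge_2[OF gl] by (intro cfl_coefficient[where \<beta> = "beta p"]) auto
  qed (simp add: Jk_def sum_nonneg)
  also have "\<dots> = - (2 * (light p * dt p / (dx p)\<^sup>2)) * (\<Sum>k<?K. (mu p k)\<^sup>2 * Jk k)"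
    unfolding sum_distrib_left by (intro sum.cong refl) simp
  \<comment> \<open>The nodal surplus has coefficient 2, and bounding the first moment by the nodal
    values costs a factor 3: hence 2 / 3.\<close>
  also have "\<dots> \<le> - (2 * (light p * dt p / (dx p)\<^sup>2)) * ((\<Sum>i<Nx p. (jump (bc p) (col gh 0) i)\<^sup>2) / 3)"
    using sum_jump_first_moment_le[OF gl pos(4) gh J] pos
    by (intro mult_left_mono_neg) (simp_all add: Jk_def x_def)
  finally have diss: "(\<Sum>k<?K. eps p / dx p * ((mu p k)\<^sup>2 / (4 * l) - \<bar>mu p k\<bar> / 2) * Jk k)
      - sigma0 p / 4 * (\<Sum>k<?K. Jk k)
      \<le> - 2 / 3 * (light p * dt p / (dx p)\<^sup>2) * (\<Sum>i<Nx p. (jump (bc p) (col gh 0) i)\<^sup>2)"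
    unfolding left_diff_distrib sum_subtractf sum_distrib_left[symmetric] by simp
  have pol: "a / 2 * (frob gh gh - frob g g) = a * frob (gh - g) gh - a / 2 * (\<Sum>k<?K. Ek k)"
  proof -
    have "frob gh gh - frob g g = 2 * frob (gh - g) gh - (\<Sum>k<?K. Ek k)"
      using frob_polarization[of gh g] E by simp
    then show ?thesis by (simp add: right_diff_distrib)
  qed
  have outer: "frob (outer_prod (s_vec p h T) (b_vec p)) gh = \<gamma>1 * (\<Sum>j<nJ p. s_vec p h T $ j * gh $$ (j, 0))"
    using frob_outer_prod_b[of gh "s_vec p h T" p] gh pos by simp
  show ?thesis
    using pol flux absorb diss tested unfolding outer a_def[symmetric] mult_minus_left by linarith
qed

section \<open>Energy\<close>

text \<open>Adding \<open>a\<close> times the temperature equation removes the exchange term, so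
  \<open>a * T + k * h\<close> changes only by \<open>\<delta>\<close>. Testing this with the new
  value produces \<open>- 2 * \<tau> * \<sigma> * h' * (a * T')\<close>, which cancels the growth of
  the temperature energy; the weight \<open>a * c\<^sub>\<nu> / 2\<close> is the one that makes the
  two match. Shifting the flux term to the old value leaves
  \<open>- \<tau> * \<gamma> * D * \<delta> - \<delta>\<^sup>2\<close>, and completing the square
  gives the last term.\<close>

lemma ht_cell_energy:
  fixes a \<tau> \<sigma> k \<gamma> c\<^sub>\<nu> D h h' T T' :: real
  assumes pos: "0 < \<tau>" "0 < a" "0 < c\<^sub>\<nu>" "0 \<le> \<sigma>" "0 \<le> k"
    and h: "k * ((h' - h) / \<tau>) + a * (2 / c\<^sub>\<nu>) * \<sigma> * h' + \<gamma> / 2 * D = - \<sigma> * h'"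
    and T: "(T' - T) / \<tau> = 2 / c\<^sub>\<nu> * \<sigma> * h'"
  shows "(a * T' + k * h')\<^sup>2 + a * c\<^sub>\<nu> / 2 * T'\<^sup>2
    \<le> (a * T + k * h)\<^sup>2 + a * c\<^sub>\<nu> / 2 * T\<^sup>2 - \<tau> * \<gamma> * (D * (a * T + k * h)) + \<tau>\<^sup>2 * \<gamma>\<^sup>2 / 4 * D\<^sup>2"
proof -
  define \<delta> where "\<delta> = - \<tau> * (\<gamma> / 2 * D + \<sigma> * h')"
  have dT: "T' - T = \<tau> * (2 / c\<^sub>\<nu> * \<sigma> * h')"
    using T pos by (simp add: field_simps)
  have "k * ((h' - h) / \<tau>) = - \<sigma> * h' - a * (2 / c\<^sub>\<nu> * \<sigma> * h') - \<gamma> / 2 * D"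
    using h by (simp add: algebra_simps)
  then have "\<tau> * (k * ((h' - h) / \<tau>)) = \<tau> * (- \<sigma> * h' - a * (2 / c\<^sub>\<nu> * \<sigma> * h') - \<gamma> / 2 * D)"
    by simp
  moreover have "\<tau> * (k * ((h' - h) / \<tau>)) = k * (h' - h)"
    using pos by simp
  ultimately have "k * (h' - h) = \<delta> - a * (T' - T)"
    unfolding dT \<delta>_def by (simp add: algebra_simps)
  then have B': "a * T' + k * h' = (a * T + k * h) + \<delta>"
    by (simp add: algebra_simps)
  have "a * c\<^sub>\<nu> / 2 * T'\<^sup>2 - a * c\<^sub>\<nu> / 2 * T\<^sup>2
      = a * c\<^sub>\<nu> * (T' * (T' - T)) - a * c\<^sub>\<nu> / 2 * (T' - T)\<^sup>2"
    by (simp add: power2_eq_square field_simps)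
  also have "\<dots> \<le> a * c\<^sub>\<nu> * (T' * (T' - T))"
    using pos by simp
  also have "\<dots> = 2 * \<tau> * \<sigma> * h' * (a * T')"
    unfolding dT using pos by (simp add: field_simps)
  finally have energyT: "a * c\<^sub>\<nu> / 2 * T'\<^sup>2 - a * c\<^sub>\<nu> / 2 * T\<^sup>2 \<le> 2 * \<tau> * \<sigma> * h' * (a * T')" .
  have "(a * T' + k * h')\<^sup>2 - (a * T + k * h)\<^sup>2 = 2 * \<delta> * (a * T' + k * h') - \<delta>\<^sup>2"
    unfolding B' by (simp add: power2_eq_square algebra_simps)
  also have "\<dots> = - (\<tau> * \<gamma> * D * (a * T' + k * h')) - 2 * \<tau> * \<sigma> * h' * (a * T' + k * h') - \<delta>\<^sup>2"
    by (simp add: \<delta>_def algebra_simps)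
  also have "\<tau> * \<gamma> * D * (a * T' + k * h') = \<tau> * \<gamma> * D * (a * T + k * h) + \<tau> * \<gamma> * D * \<delta>"
    unfolding B' by (simp add: algebra_simps)
  finally have energyB: "(a * T' + k * h')\<^sup>2 - (a * T + k * h)\<^sup>2
      = - (\<tau> * \<gamma> * (D * (a * T + k * h))) - \<tau> * \<gamma> * D * \<delta> - \<delta>\<^sup>2
        - 2 * \<tau> * \<sigma> * h' * (a * T') - 2 * (\<tau> * \<sigma> * k * h'\<^sup>2)"
    by (simp add: power2_eq_square algebra_simps)
  have "0 \<le> \<tau> * \<sigma> * k * h'\<^sup>2"
    using pos by simp
  moreover have "0 \<le> (\<tau> * \<gamma> * D / 2 + \<delta>)\<^sup>2"
    by simp
  moreover have "(\<tau> * \<gamma> * D / 2 + \<delta>)\<^sup>2 = \<tau>\<^sup>2 * \<gamma>\<^sup>2 / 4 * D\<^sup>2 + \<tau> * \<gamma> * D * \<delta> + \<delta>\<^sup>2"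
    by (simp add: power2_eq_square algebra_simps)
  ultimately show ?thesis
    using energyT energyB by linarith
qed

text \<open>This is the midpoint quantity of the first energy term; the source \<open>s_vec\<close>
  is \<open>light p\<close> times its \<open>delta0\<close>, so the moments couple to it
  alone.\<close>

definition total_radiation :: "bug_params \<Rightarrow> real vec \<Rightarrow> real vec \<Rightarrow> nat \<Rightarrow> real" where
  "total_radiation p h T i = rad p * T $ i + (eps p)\<^sup>2 / light p * h $ i"

lemma energy_expand:
  assumes adm: "admissible p" and "h \<in> carrier_vec (Nx p)" "T \<in> carrier_vec (Nx p)"
  shows "energy p X S V h T = dx p *
    ((\<Sum>i<Nx p. (total_radiation p h T i)\<^sup>2 + rad p * cnu p / 2 * (T $ i)\<^sup>2)
      + (eps p)\<^sup>2 / (2 * (light p)\<^sup>2) * frob (X * S * transpose_mat V) (X * S * transpose_mat V))"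
proof -
  have pos: "0 < dx p" "0 < rad p" "0 < cnu p" "0 < light p"
    using adm by (auto simp: admissible_def)
  have mid: "(mid_norm p u)\<^sup>2 = (\<Sum>i<Nx p. (u $ i)\<^sup>2) * dx p" for u
    using pos by (simp add: mid_norm_def sum_nonneg)
  have "(\<Sum>i<Nx p. ((rad p \<cdot>\<^sub>v T + ((eps p)\<^sup>2 / light p) \<cdot>\<^sub>v h) $ i)\<^sup>2)
      = (\<Sum>i<Nx p. (total_radiation p h T i)\<^sup>2)"
    using assms by (intro sum.cong refl) (simp add: total_radiation_def)
  moreover have "(\<Sum>i<Nx p. ((sqrt (rad p * cnu p / 2) \<cdot>\<^sub>v T) $ i)\<^sup>2)
      = (\<Sum>i<Nx p. rad p * cnu p / 2 * (T $ i)\<^sup>2)"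
    using assms pos by (intro sum.cong refl) (simp add: power_mult_distrib)
  moreover have "(iface_norm p (s \<cdot>\<^sub>m A))\<^sup>2 = s\<^sup>2 * frob A A * dx p" for s A
  proof -
    have "frob (s \<cdot>\<^sub>m A) (s \<cdot>\<^sub>m A) = s\<^sup>2 * frob A A"
      by (simp add: frob_def sum_distrib_left power2_eq_square mult_ac)
    then show ?thesis
      using pos by (simp add: iface_norm_def frobenius_norm_square frob_nonneg)
  qed
  moreover have "(eps p / (\<gamma>0 * light p))\<^sup>2 = (eps p)\<^sup>2 / (2 * (light p)\<^sup>2)"
    by (simp add: \<gamma>0_def power_divide power_mult_distrib)
  ultimately show ?thesis
    unfolding energy_def mid by (simp add: sum.distrib algebra_simps)
qed

lemma sum_s_vec:
  assumes h: "h \<in> carrier_vec (Nx p)" and T: "T \<in> carrier_vec (Nx p)" and n: "0 < Nx p"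
    and u: "dim_vec u = nJ p" and c: "0 < light p"
  shows "(\<Sum>j<nJ p. s_vec p h T $ j * u $ j)
    = - (light p / dx p) * (\<Sum>i<Nx p. jump (bc p) u i * total_radiation p h T i)"
proof -
  let ?B = "total_radiation p h T"
  have "s_vec p h T $ j = light p / dx p * (?B ((j + 1) mod Nx p) - ?B j)" if "j < nJ p" for j
  proof -
    have "j < Nx p"
      using that by (cases "bc p") (auto simp: num_ifaces_def)
    moreover have "(j + 1) mod Nx p < Nx p"
      using n by simp
    ultimately have "s_vec p h T $ j
        = ((rad p * light p * T $ ((j + 1) mod Nx p) + (eps p)\<^sup>2 * h $ ((j + 1) mod Nx p))
          - (rad p * light p * T $ j + (eps p)\<^sup>2 * h $ j)) / dx p"
      using that h T by (simp add: s_vec_def delta0_def)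
    moreover have "rad p * light p * x + (eps p)\<^sup>2 * y = light p * (rad p * x + (eps p)\<^sup>2 / light p * y)" for x y
      using c by (simp add: field_simps)
    ultimately show ?thesis
      by (simp only: total_radiation_def right_diff_distrib[symmetric]) simp
  qed
  then have "(\<Sum>j<nJ p. s_vec p h T $ j * u $ j)
      = light p / dx p * (\<Sum>j<nJ p. (?B ((j + 1) mod Nx p) - ?B j) * u $ j)"
    by (simp add: sum_distrib_left mult.assoc)
  then show ?thesis
    unfolding sum_by_parts_mids[OF u n] by simp
qed

lemma v_augmented_first_col:
  assumes "v_augmented p V L' Vh" "0 < Nang p"
  shows "col Vh 0 = unit_vec (Nang p) 0"
proof -
  have "0 < \<gamma>1" by (simp add: \<gamma>1_def)
  moreover have "vec_norm (b_vec p) = \<gamma>1"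
    using \<open>0 < \<gamma>1\<close> assms(2) by (simp add: vec_norm_def b_vec_def)
  ultimately show ?thesis
    using assms by (simp add: v_augmented_def b_vec_def smult_smult_assoc)
qed

theorem theorem7:
  fixes p :: bug_params and \<theta> :: real and r :: nat
    and X S V X' S' V' :: "real Matrix.mat" and h T h' T' :: "real Matrix.vec"
  assumes "admissible p"
    and "2 * r + 1 \<le> min (nJ p) (Nang p)"
    and "X \<in> carrier_mat (nJ p) r" and "orthonormal_cols X"
    and "S \<in> carrier_mat r r"
    and "V \<in> carrier_mat (Nang p) r" and "orthonormal_cols V"
    and "h \<in> carrier_vec (Nx p)" and "T \<in> carrier_vec (Nx p)"
    and CFL: "\<forall>k\<le>Nang p. mu p k \<noteq> 0 \<longrightarrow>
      dt p \<le> 1 / (5 * light p * beta p) *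
        (2 * eps p * dx p / \<bar>mu p k\<bar> + sigma0 p * (dx p)\<^sup>2 / (mu p k)\<^sup>2)"
    and "bug_step p \<theta> X S V h T X' S' V' h' T'"
  shows "energy p X' S' V' h' T' \<le> energy p X S V h T"
proof -
  have pos: "0 < eps p" "0 < light p" "0 < rad p" "0 < cnu p" "0 < sigma0 p" "0 < Nang p"
    "0 < Nx p" "0 < dx p" "0 < dt p"
    using assms(1) by (auto simp: admissible_def)
  have J: "0 < nJ p" using assms(2) by simp
  obtain K' Xh L' Vh Sh where x: "x_augmented p X T K' Xh" and v: "v_augmented p V L' Vh"
    and gal: "galerkin_step p X S V h T Xh Vh Sh" and trunc: "truncation \<theta> Xh Sh Vh X' S' V'"
    and ht: "ht_update p h T X' S' V' h' T'"
    using assms(11) unfolding bug_step_def by blast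
  have Xh: "Xh \<in> carrier_mat (nJ p) (Suc (2 * r))" "orthonormal_cols Xh" "set (cols X) \<subseteq> col_range Xh"
    using x assms(3) by (auto simp: x_augmented_def)
  have Vh: "Vh \<in> carrier_mat (Nang p) (Suc (2 * r))" "orthonormal_cols Vh" "set (cols V) \<subseteq> col_range Vh"
    using v assms(6) by (auto simp: v_augmented_def)
  have Sh: "Sh \<in> carrier_mat (Suc (2 * r)) (Suc (2 * r))"
    using gal Xh(1) Vh(1) by (auto simp: galerkin_step_def Let_def)
  define g where "g = X * S * transpose_mat V"
  define gh where "gh = Xh * Sh * transpose_mat Vh"
  define g' where "g' = X' * S' * transpose_mat V'"
  have g: "g \<in> carrier_mat (nJ p) (Nang p)" and gh: "gh \<in> carrier_mat (nJ p) (Nang p)"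
    using assms(3,6) Xh(1) Vh(1) by (auto simp: g_def gh_def)
  note effect = truncation_effect[OF trunc Xh(1) Sh Vh(1,2) v_augmented_first_col[OF v pos(6)] pos(6),
      folded gh_def g'_def]
  define G where "G = col gh 0"
  have G: "dim_vec G = nJ p" using gh by (simp add: G_def)
  \<comment> \<open>The macroscopic update uses the truncated moments, the dissipation controls
    jumps of the untruncated ones; here the two first moments are identified.\<close>
  have g1: "g' *\<^sub>v unit_vec (Nang p) 0 = G"
    using effect(1,3) gh pos(6) by (intro eq_vecI) (auto simp: G_def)
  let ?B = "total_radiation p h T" and ?B' = "total_radiation p h' T'"
  define JB where "JB = (\<Sum>i<Nx p. jump (bc p) G i * ?B i)"
  define JJ where "JJ = (\<Sum>i<Nx p. (jump (bc p) G i)\<^sup>2)"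
  have h': "h' \<in> carrier_vec (Nx p)" "T' \<in> carrier_vec (Nx p)"
    and upd: "\<And>i. i < Nx p \<Longrightarrow>
      (eps p)\<^sup>2 / light p * ((h' $ i - h $ i) / dt p)
        + rad p * (2 / cnu p) * sigma_mid p i * h' $ i + \<gamma>1 / 2 * (jump (bc p) G i / dx p)
        = - sigma_mid p i * h' $ i \<and>
      (T' $ i - T $ i) / dt p = 2 / cnu p * sigma_mid p i * h' $ i"
    using ht unfolding ht_update_def Let_def g'_def[symmetric] g1
    by (auto simp: D0_def jump_def kappa_def)
  have \<gamma>1: "\<gamma>1\<^sup>2 = 2 / 3" by (simp add: \<gamma>1_def)
  have "(\<Sum>i<Nx p. (?B' i)\<^sup>2 + rad p * cnu p / 2 * (T' $ i)\<^sup>2)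
      \<le> (\<Sum>i<Nx p. (?B i)\<^sup>2 + rad p * cnu p / 2 * (T $ i)\<^sup>2
          - dt p * \<gamma>1 * (jump (bc p) G i / dx p * ?B i)
          + (dt p)\<^sup>2 * \<gamma>1\<^sup>2 / 4 * (jump (bc p) G i / dx p)\<^sup>2)"
    unfolding total_radiation_def
  proof (intro sum_mono ht_cell_energy)
    fix i assume "i \<in> {..<Nx p}"
    then have i: "i < Nx p" by simp
    show "0 \<le> sigma_mid p i"
      using sigma_mid_ge[OF assms(1) i] pos(5) by simp
  qed (use pos upd in auto)
  also have "\<dots> = (\<Sum>i<Nx p. (?B i)\<^sup>2 + rad p * cnu p / 2 * (T $ i)\<^sup>2)
      - dt p * \<gamma>1 / dx p * JB + (dt p)\<^sup>2 / (6 * (dx p)\<^sup>2) * JJ"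
    unfolding \<gamma>1 JB_def JJ_def sum_distrib_left
    by (simp add: sum.distrib sum_subtractf power_divide mult_ac)
  finally have macro: "(\<Sum>i<Nx p. (?B' i)\<^sup>2 + rad p * cnu p / 2 * (T' $ i)\<^sup>2)
      \<le> (\<Sum>i<Nx p. (?B i)\<^sup>2 + rad p * cnu p / 2 * (T $ i)\<^sup>2)
      - dt p * \<gamma>1 / dx p * JB + (dt p)\<^sup>2 / (6 * (dx p)\<^sup>2) * JJ" .
  have "(\<Sum>j<nJ p. s_vec p h T $ j * gh $$ (j, 0)) = (\<Sum>j<nJ p. s_vec p h T $ j * G $ j)"
    using gh pos(6) by (intro sum.cong refl) (simp add: G_def)
  also have "\<dots> = - (light p / dx p) * JB"
    unfolding JB_def by (rule sum_s_vec[OF assms(8,9) pos(7) G pos(2)])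
  finally have source: "(\<Sum>j<nJ p. s_vec p h T $ j * gh $$ (j, 0)) = - (light p / dx p) * JB" .
  have "(eps p)\<^sup>2 / light p / dt p / 2 * (frob gh gh - frob g g)
      \<le> \<gamma>1 * (light p / dx p) * JB - 2 / 3 * (light p * dt p / (dx p)\<^sup>2) * JJ"
    using moment_dissipation[OF assms(1) J g gh CFL
        galerkin_tested[OF assms(3,5,6) Xh Vh gal, folded g_def gh_def]]
    unfolding source JJ_def G_def by simp
  \<comment> \<open>The factor \<open>dt p / light p\<close> yields the weight of the moments in the
    energy, and it makes the coefficient of \<open>JB\<close> the exact opposite of the one in
    \<open>macro\<close>.\<close>
  then have scaled: "dt p / light p * ((eps p)\<^sup>2 / light p / dt p / 2 * (frob gh gh - frob g g))
      \<le> dt p / light p * (\<gamma>1 * (light p / dx p) * JB - 2 / 3 * (light p * dt p / (dx p)\<^sup>2) * JJ)"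
    using pos by (intro mult_left_mono) auto
  have "(eps p)\<^sup>2 / (2 * (light p)\<^sup>2) * (frob gh gh - frob g g)
      \<le> dt p * \<gamma>1 / dx p * JB - 2 / 3 * ((dt p)\<^sup>2 / (dx p)\<^sup>2) * JJ"
  proof -
    have "dt p / light p * ((eps p)\<^sup>2 / light p / dt p / 2 * y) = (eps p)\<^sup>2 / (2 * (light p)\<^sup>2) * y" for y
      using pos by (simp add: field_simps power2_eq_square)
    moreover have "dt p / light p * (\<gamma>1 * (light p / dx p) * JB - 2 / 3 * (light p * dt p / (dx p)\<^sup>2) * JJ)
        = dt p * \<gamma>1 / dx p * JB - 2 / 3 * ((dt p)\<^sup>2 / (dx p)\<^sup>2) * JJ"
      using pos by (simp add: right_diff_distrib power2_eq_square)
    ultimately show ?thesis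
      using scaled by (simp only:)
  qed
  moreover have "(eps p)\<^sup>2 / (2 * (light p)\<^sup>2) * frob g' g' \<le> (eps p)\<^sup>2 / (2 * (light p)\<^sup>2) * frob gh gh"
    using effect(2) by (intro mult_left_mono) auto
  \<comment> \<open>The left side is the cost of the mixed time levels, with 1 / 6 equal to
    \<open>\<gamma>1\<^sup>2 / 4\<close>; the right side is the surplus of the moment
    balance.\<close>
  moreover have "(dt p)\<^sup>2 / (6 * (dx p)\<^sup>2) * JJ \<le> 2 / 3 * ((dt p)\<^sup>2 / (dx p)\<^sup>2) * JJ"
    using pos by (intro mult_right_mono) (auto simp: JJ_def sum_nonneg field_simps)
  ultimately have "(\<Sum>i<Nx p. (?B' i)\<^sup>2 + rad p * cnu p / 2 * (T' $ i)\<^sup>2)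
        + (eps p)\<^sup>2 / (2 * (light p)\<^sup>2) * frob g' g'
      \<le> (\<Sum>i<Nx p. (?B i)\<^sup>2 + rad p * cnu p / 2 * (T $ i)\<^sup>2)
        + (eps p)\<^sup>2 / (2 * (light p)\<^sup>2) * frob g g"
    using macro unfolding right_diff_distrib by linarith
  then show ?thesis
    unfolding energy_expand[OF assms(1) h'] energy_expand[OF assms(1,8,9)] g_def[symmetric] g'_def[symmetric]
    using pos(8) by (intro mult_left_mono) auto
qed

end
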